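(* Let $r\ge 2$ be an integer. There exists $n_0=n_0(r)$ such that for all $n\ge n_0$ the following hold: (i) if $1\le k<r$, then $\mathrm{ex}(n,K_k,2K_r)=\mathcal{N}(K_k,\,K_1\vee T(n-1,r-1))$; (ii) if $r\le k<2r$, then $\mathrm{ex}(n,\{K_k,K_{k+1},\dots,K_{2r-1}\},2K_r)=\mathcal{N}(K_k,\,K_{2k-2r+1}\vee T(n-2k+2r-1,\,2r-k-1))$.
   Context: All graphs are finite and simple. A graph is $F$-free if it does not contain $F$ as a (not necessarily induced) subgraph. $\mathcal{N}(H,G)$ denotes the number of unlabeled copies of $H$ in $G$, i.e. the number of (not necessarily induced) subgraphs of $G$ isomorphic to $H$. $\mathrm{ex}(n,H,F)$ is the maximum of $\mathcal{N}(H,G)$ over all $n$-vertex $F$-free graphs $G$. For a family $\mathcal{H}$ of graphs, $\mathrm{ex}(n,\mathcal{H},F)$ is the maximum of $\sum_{H\in\mathcal{H}}\mathcal{N}(H,G)$ over all $n$-vertex $F$-free graphs $G$. $K_m$ is the complete graph on $m$ vertices, and $2K_r$ is the graph consisting of two vertex-disjoint copies of $K_r$. $T(m,s)$ is the Turán graph: the complete $s$-partite graph on $m$ vertices with each part having order $\lfloor m/s\rfloor$ or $\lceil m/s\rceil$; by convention $T(m,0)$ is the graph with no vertices (this only arises when $k=2r-1$ in (ii), where the right-hand side is then $\mathcal{N}(K_{2r-1},K_{2r-1})=1$). $G_1\vee G_2$ is the join: the graph obtained from vertex-disjoint copies of $G_1,G_2$ by joining every vertex of $G_1$ to every vertex of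 $G_2$. *)

theory Defs
  imports Complex_Main
begin

record 'a ugraph =
  verts :: "'a set"
  edges :: "'a set set"

definition simple_graph :: "'a ugraph \<Rightarrow> bool" where
  "simple_graph G \<longleftrightarrow> finite (verts G) \<and> (\<forall>e\<in>edges G. e \<subseteq> verts G \<and> card e = 2)"

definition subgraph :: "'a ugraph \<Rightarrow> 'a ugraph \<Rightarrow> bool" where
  "subgraph S G \<longleftrightarrow> simple_graph S \<and> verts S \<subseteq> verts G \<and> edges S \<subseteq> edges G"

definition isomorphic :: "'a ugraph \<Rightarrow> 'b ugraph \<Rightarrow> bool" where
  "isomorphic G H \<longleftrightarrow> (\<exists>f. bij_betw f (verts G) (verts H) \<and> edges H = (\<lambda>e. f ` e) ` edges G)"

definition copies :: "'b ugraph \<Rightarrow> 'a ugraph \<Rightarrow> 'a ugraph set" where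
  "copies H G = {S. subgraph S G \<and> isomorphic H S}"

definition num_copies :: "'b ugraph \<Rightarrow> 'a ugraph \<Rightarrow> nat" where
  "num_copies H G = card (copies H G)"

definition free_of :: "'b ugraph \<Rightarrow> 'a ugraph \<Rightarrow> bool" where
  "free_of F G \<longleftrightarrow> \<not> (\<exists>S. subgraph S G \<and> isomorphic F S)"

text \<open>Every finite graph is isomorphic to one with vertices in \<^typ>\<open>nat\<close>, so letting the host
  graphs range over \<^typ>\<open>nat ugraph\<close> loses nothing. The sets of values below are finite, since
  the number of subgraphs of an n-vertex graph is bounded in terms of n, and they are nonempty
  whenever F has an edge.\<close>

definition ex :: "nat \<Rightarrow> 'b ugraph \<Rightarrow> 'c ugraph \<Rightarrow> nat" where
  "ex n H F =
     Max {num_copies H G | G :: nat ugraph. simple_graph G \<and> card (verts G) = n \<and> free_of F G}"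

definition ex_family :: "nat \<Rightarrow> 'b ugraph set \<Rightarrow> 'c ugraph \<Rightarrow> nat" where
  "ex_family n \<H> F =
     Max {(\<Sum>H\<in>\<H>. num_copies H G) | G :: nat ugraph.
            simple_graph G \<and> card (verts G) = n \<and> free_of F G}"

definition complete_graph :: "nat \<Rightarrow> nat ugraph" where
  "complete_graph m = \<lparr>verts = {..<m}, edges = {e. e \<subseteq> {..<m} \<and> card e = 2}\<rparr>"

definition disjoint_union :: "'a ugraph \<Rightarrow> 'b ugraph \<Rightarrow> ('a + 'b) ugraph" where
  "disjoint_union G H =
     \<lparr>verts = verts G <+> verts H,
      edges = (\<lambda>e. Inl ` e) ` edges G \<union> (\<lambda>e. Inr ` e) ` edges H\<rparr>"

definition join :: "'a ugraph \<Rightarrow> 'b ugraph \<Rightarrow> ('a + 'b) ugraph" where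
  "join G H =
     \<lparr>verts = verts G <+> verts H,
      edges = edges (disjoint_union G H) \<union> {{Inl u, Inr v} | u v. u \<in> verts G \<and> v \<in> verts H}\<rparr>"

text \<open>The parts of the Turan graph are the residue classes modulo s; they have the required
  orders by \<open>turan_part_order\<close>. For \<open>s = 0\<close> the graph has no vertices, whatever m is.\<close>

definition turan_graph :: "nat \<Rightarrow> nat \<Rightarrow> nat ugraph" where
  "turan_graph m s =
     (if s = 0 then \<lparr>verts = {}, edges = {}\<rparr>
      else \<lparr>verts = {..<m}, edges = {{u, v} | u v. u < m \<and> v < m \<and> u mod s \<noteq> v mod s}\<rparr>)"

lemma turan_part_order:
  assumes "i < s"
  shows "int (card {v \<in> verts (turan_graph m s). v mod s = i})
           \<in> {\<lfloor>real m / real s\<rfloor>, \<lceil>real m / real s\<rceil>}"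
proof -
  define q t where "q = m div s" and "t = m mod s"
  have m: "m = q * s + t" and t: "t < s"
    using assms by (auto simp: q_def t_def)
  define c where "c = q + (if i < t then 1 else 0)"
  have "{v \<in> verts (turan_graph m s). v mod s = i} = (\<lambda>j. j * s + i) ` {..<c}" (is "?L = ?R")
  proof
    show "?L \<subseteq> ?R"
    proof
      fix v assume "v \<in> ?L"
      then have v: "v < m" "v mod s = i"
        using assms by (auto simp: turan_graph_def)
      define j where "j = v div s"
      have vj: "v = j * s + i"
        using v(2) unfolding j_def by (metis div_mult_mod_eq)
      have "j < c"
      proof (rule ccontr)
        assume "\<not> j < c"
        then have "c * s \<le> j * s" by (intro mult_le_mono1) simp
        moreover have "m \<le> c * s + i"
          using m t by (simp add: c_def)
        ultimately show False
          using v(1) vj by linarith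
      qed
      with vj show "v \<in> ?R" by blast
    qed
  next
    show "?R \<subseteq> ?L"
    proof
      fix v assume "v \<in> ?R"
      then obtain j where j: "j < c" "v = j * s + i" by blast
      have "v < m"
      proof (cases "j < q")
        case True
        then have "Suc j * s \<le> q * s" by (intro mult_le_mono1) simp
        then show ?thesis using j m assms by simp
      next
        case False
        then have "j = q" "i < t" using j(1) by (auto simp: c_def split: if_splits)
        then show ?thesis using j(2) m by simp
      qed
      then show "v \<in> ?L" using j assms by (auto simp: turan_graph_def)
    qed
  qed
  moreover have "inj_on (\<lambda>j. j * s + i) {..<c}"
    using assms by (auto simp: inj_on_def)
  ultimately have card: "card {v \<in> verts (turan_graph m s). v mod s = i} = c"
    by (simp add: card_image)
  have floor: "\<lfloor>real m / real s\<rfloor> = int q"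
    by (simp add: q_def floor_divide_of_nat_eq)
  show ?thesis
  proof (cases "i < t")
    case False
    then show ?thesis using card floor by (simp add: c_def)
  next
    case True
    have "real m / real s = real q + real t / real s"
      using assms m by (simp add: field_simps)
    moreover have "0 < real t / real s" "real t / real s \<le> 1"
      using True t assms by auto
    ultimately have "\<lceil>real m / real s\<rceil> = int q + 1"
      by (intro ceiling_unique) auto
    then show ?thesis using card True by (simp add: c_def)
  qed
qed

end

theory Submission
  imports Defs "HOL-Library.FuncSet"
begin

text \<open>Copies of \<open>K\<^sub>k\<close> in a graph are cliques of order k, and a graph is \<open>2K\<^sub>r\<close>-free iff its r-cliques
  pairwise meet. So the theorem is about intersecting families of cliques, and every upper bound
  comes from one dichotomy: either the family has a common core, which is split off and leaves a
  graph to which Zykov's theorem (\<open>zykov\<close>) applies, or, by \<open>intersecting_kernel\<close>, there are boundedly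
  many sets, one element larger than the guaranteed intersections, such that every member contains
  one of them, and then the family is too small by a factor of order n. The joins themselves are
  \<open>2K\<^sub>r\<close>-free because each r-clique needs more than half of the vertices outside the Turan graph
  (\<open>pairwise_meeting_join_turan\<close>).

  For \<open>k = 1\<close> both sides are n. For \<open>2 \<le> k < r\<close> write \<open>s = r - 1\<close> and apply this to the r-cliques. If some vertex lies in all of
  them, deleting it leaves a \<open>K\<^sub>r\<close>-free graph, and Zykov's theorem bounds the k-cliques avoiding the
  vertex and the (k-1)-cliques extended by it; this is the count in \<open>K\<^sub>1 \<or> T(n-1, s)\<close>. Otherwise
  there is a bounded set P of pairs such that each r-clique contains one of them. Removing the edges
  in P makes the graph \<open>K\<^sub>r\<close>-free and destroys only \<open>O(n\<^bsup>k-2\<^esup>)\<close> of the k-cliques, so at most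
  \<open>N(K\<^sub>k, T(n, s)) + O(n\<^bsup>k-2\<^esup>)\<close> of them existed. This is smaller than the claimed value, because
  in \<open>K\<^sub>1 \<or> T(n-1, s)\<close> one vertex of \<open>T(n, s)\<close> has become adjacent to its own part, which creates
  at least \<open>\<lfloor>(n-1)/s\<rfloor>\<^bsup>k-1\<^esup>\<close> new k-cliques (\<open>card_turan_cliques_Suc\<close>).

  For \<open>r \<le> k < 2r\<close> write \<open>m = 2k - 2r + 1\<close> and \<open>s = 2r - k - 1\<close>, so \<open>m + s = k\<close>. Two
  cliques of order at least r whose union has at least 2r vertices contain disjoint r-cliques, so any two
  k-cliques share m vertices. If all of them contain a common m-set M, there are no larger cliques,
  and the k-cliques correspond to the s-cliques of the common neighbourhood of M, which is
  \<open>K\<^bsub>s+1\<^esub>\<close>-free; Zykov's theorem applies. Otherwise the k-cliques, and likewise the larger cliques,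
  number only \<open>O(n\<^bsup>s-1\<^esup>)\<close>, while \<open>T(n-m, s)\<close> has at least \<open>\<lfloor>(n-m)/s\<rfloor>\<^sup>s\<close> cliques of order s.\<close>

section \<open>Cliques as vertex sets\<close>

definition is_clique :: "'a set set \<Rightarrow> 'a set \<Rightarrow> bool" where
  "is_clique E C \<longleftrightarrow> (\<forall>x\<in>C. \<forall>y\<in>C. x \<noteq> y \<longrightarrow> {x, y} \<in> E)"

definition cliques :: "'a set \<Rightarrow> 'a set set \<Rightarrow> nat \<Rightarrow> 'a set set" where
  "cliques V E k = {C. C \<subseteq> V \<and> card C = k \<and> is_clique E C}"

abbreviation pairs :: "'a set \<Rightarrow> 'a set set" where
  "pairs C \<equiv> {e. e \<subseteq> C \<and> card e = 2}"

lemma is_clique_subset: "is_clique E C \<Longrightarrow> D \<subseteq> C \<Longrightarrow> is_clique E D"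
  by (auto simp: is_clique_def)

lemma is_clique_mono: "is_clique E C \<Longrightarrow> E \<subseteq> E' \<Longrightarrow> is_clique E' C"
  by (auto simp: is_clique_def)

lemma is_clique_iff_pairs: "is_clique E C \<longleftrightarrow> pairs C \<subseteq> E"
proof
  assume "pairs C \<subseteq> E"
  moreover have "{x, y} \<in> pairs C" if "x \<in> C" "y \<in> C" "x \<noteq> y" for x y
    using that by simp
  ultimately show "is_clique E C" unfolding is_clique_def by blast
qed (auto simp: is_clique_def card_2_iff)

lemma is_clique_Un:
  "is_clique E (C \<union> D) \<longleftrightarrow>
     is_clique E C \<and> is_clique E D \<and> (\<forall>x\<in>C. \<forall>y\<in>D. x \<noteq> y \<longrightarrow> {x, y} \<in> E)"
proof -
  have "{x, y} \<in> E" if "\<forall>x\<in>C. \<forall>y\<in>D. x \<noteq> y \<longrightarrow> {x, y} \<in> E" "x \<in> D" "y \<in> C" "x \<noteq> y" for x y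
    using that by (metis insert_commute)
  then show ?thesis unfolding is_clique_def ball_Un by blast
qed

lemma cliques_subset_Pow: "cliques V E k \<subseteq> Pow V"
  by (auto simp: cliques_def)

lemma finite_cliques [simp]: "finite V \<Longrightarrow> finite (cliques V E k)"
  by (rule finite_subset[OF cliques_subset_Pow]) simp

lemma finite_clique: "C \<in> cliques V E k \<Longrightarrow> finite V \<Longrightarrow> finite C"
  by (auto simp: cliques_def dest: finite_subset)

lemma cliques_mono: "V \<subseteq> V' \<Longrightarrow> E \<subseteq> E' \<Longrightarrow> cliques V E k \<subseteq> cliques V' E' k"
  by (auto simp: cliques_def intro: is_clique_mono)

lemma cliques_0: "finite V \<Longrightarrow> cliques V E 0 = {{}}"
  by (auto simp: cliques_def is_clique_def dest: finite_subset)

lemma cliques_empty_verts: "cliques {} E k = (if k = 0 then {{}} else {})"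
  by (auto simp: cliques_def is_clique_def)

lemma cliques_1: "cliques V E 1 = (\<lambda>x. {x}) ` V"
  by (auto simp: cliques_def is_clique_def card_1_singleton_iff)

lemma card_cliques_1: "card (cliques V E 1) = card V"
  unfolding cliques_1 by (rule card_image) (auto simp: inj_on_def)

lemma cliques_empty_larger:
  assumes "finite V" "cliques V E k = {}" "k \<le> j"
  shows "cliques V E j = {}"
proof (rule ccontr)
  assume "cliques V E j \<noteq> {}"
  then obtain C where C: "C \<subseteq> V" "card C = j" "is_clique E C"
    by (auto simp: cliques_def)
  then obtain D where "D \<subseteq> C" "card D = k"
    using obtain_subset_with_card_n[of k C] assms(3) by metis
  with C have "D \<in> cliques V E k"
    by (auto simp: cliques_def intro: is_clique_subset)
  with assms(2) show False by simp
qed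

lemma card_cliques_remove_vertex:
  assumes "finite V" "k \<ge> 1"
  shows "card (cliques V E k) \<le> card (cliques (V - {v}) E k) + card (cliques (V - {v}) E (k - 1))"
proof -
  have "C \<in> cliques (V - {v}) E k \<union> insert v ` cliques (V - {v}) E (k - 1)"
    if C: "C \<in> cliques V E k" for C
  proof (cases "v \<in> C")
    case True
    have "finite C" using C assms(1) by (auto simp: cliques_def dest: finite_subset)
    then have "C - {v} \<in> cliques (V - {v}) E (k - 1)"
      using C True by (auto simp: cliques_def intro: is_clique_subset)
    moreover have "C = insert v (C - {v})" using True by auto
    ultimately show ?thesis by blast
  qed (use C in \<open>auto simp: cliques_def\<close>)
  then have "cliques V E k \<subseteq> cliques (V - {v}) E k \<union> insert v ` cliques (V - {v}) E (k - 1)"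
    by blast
  then have "card (cliques V E k)
      \<le> card (cliques (V - {v}) E k \<union> insert v ` cliques (V - {v}) E (k - 1))"
    using assms(1) by (intro card_mono) auto
  also have "\<dots> \<le> card (cliques (V - {v}) E k) + card (insert v ` cliques (V - {v}) E (k - 1))"
    by (rule card_Un_le)
  also have "\<dots> \<le> card (cliques (V - {v}) E k) + card (cliques (V - {v}) E (k - 1))"
    using assms(1) by (intro add_left_mono card_image_le) auto
  finally show ?thesis .
qed

lemma image_pairs:
  assumes "bij_betw f X Y"
  shows "(\<lambda>e. f ` e) ` pairs X = pairs Y"
proof -
  have inj: "inj_on f X" and Y: "Y = f ` X"
    using assms by (auto simp: bij_betw_def)
  have "e \<in> (\<lambda>e. f ` e) ` pairs X" if "e \<in> pairs Y" for e
  proof -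
    from that Y obtain d where d: "d \<subseteq> X" "e = f ` d" "inj_on f d"
      using subset_image_inj[of e f X] by auto
    then have "card d = 2" using that by (auto simp: card_image)
    with d show ?thesis by auto
  qed
  moreover have "f ` e \<in> pairs Y" if "e \<in> pairs X" for e
    using that Y inj by (auto simp: card_image inj_on_subset)
  ultimately show ?thesis by blast
qed

lemma simple_graph_complete: "simple_graph (complete_graph m)"
  by (simp add: simple_graph_def complete_graph_def)

lemma isomorphic_complete_iff:
  "isomorphic (complete_graph k) S \<longleftrightarrow>
     finite (verts S) \<and> card (verts S) = k \<and> edges S = pairs (verts S)"
proof
  assume "isomorphic (complete_graph k) S"
  then obtain f where f: "bij_betw f {..<k} (verts S)" "edges S = (\<lambda>e. f ` e) ` pairs {..<k}"
    by (auto simp: isomorphic_def complete_graph_def)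
  then show "finite (verts S) \<and> card (verts S) = k \<and> edges S = pairs (verts S)"
    using bij_betw_finite[OF f(1)] bij_betw_same_card[OF f(1)] image_pairs[OF f(1)] by simp
next
  assume S: "finite (verts S) \<and> card (verts S) = k \<and> edges S = pairs (verts S)"
  then obtain f where f: "bij_betw f {..<k} (verts S)"
    using ex_bij_betw_nat_finite[of "verts S"] by (auto simp: atLeast0LessThan)
  moreover have "edges S = (\<lambda>e. f ` e) ` pairs {..<k}"
    using S image_pairs[OF f] by simp
  ultimately show "isomorphic (complete_graph k) S"
    unfolding isomorphic_def complete_graph_def by (intro exI[of _ f]) simp
qed

lemma num_copies_complete:
  assumes "simple_graph G"
  shows "num_copies (complete_graph k) G = card (cliques (verts G) (edges G) k)"
proof -
  define K where "K C = \<lparr>verts = C, edges = pairs C\<rparr>" for C :: "'a set"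
  have fin: "finite (verts G)" using assms by (simp add: simple_graph_def)
  have "copies (complete_graph k) G = K ` cliques (verts G) (edges G) k"
  proof (intro set_eqI iffI)
    fix S assume "S \<in> copies (complete_graph k) G"
    then have S: "subgraph S G" "card (verts S) = k" "edges S = pairs (verts S)"
      by (auto simp: copies_def isomorphic_complete_iff)
    then have "S = K (verts S)" by (simp add: K_def)
    moreover have "verts S \<in> cliques (verts G) (edges G) k"
      using S by (simp add: cliques_def subgraph_def is_clique_iff_pairs)
    ultimately show "S \<in> K ` cliques (verts G) (edges G) k" by blast
  next
    fix S assume "S \<in> K ` cliques (verts G) (edges G) k"
    then obtain C where C: "S = K C" "C \<subseteq> verts G" "card C = k" "pairs C \<subseteq> edges G"
      by (auto simp: cliques_def is_clique_iff_pairs)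
    moreover have "finite C" using C fin finite_subset by blast
    ultimately show "S \<in> copies (complete_graph k) G"
      by (simp add: copies_def isomorphic_complete_iff subgraph_def simple_graph_def K_def)
  qed
  moreover have "inj K" by (auto simp: inj_def K_def)
  ultimately show ?thesis
    by (simp add: num_copies_def card_image inj_on_subset)
qed

abbreviation pairwise_meeting :: "'a set set \<Rightarrow> bool" where
  "pairwise_meeting \<F> \<equiv> (\<forall>A\<in>\<F>. \<forall>B\<in>\<F>. A \<inter> B \<noteq> {})"

lemma verts_disjoint_union_complete:
  "verts (disjoint_union (complete_graph r) (complete_graph r)) = Inl ` {..<r} \<union> Inr ` {..<r}"
  by (auto simp: disjoint_union_def complete_graph_def)

lemma edges_disjoint_union_complete:
  "edges (disjoint_union (complete_graph r) (complete_graph r)) =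
     pairs (Inl ` {..<r}) \<union> pairs (Inr ` {..<r})"
proof -
  have "bij_betw Inl {..<r} (Inl ` {..<r} :: (nat + nat) set)"
    "bij_betw Inr {..<r} (Inr ` {..<r} :: (nat + nat) set)"
    by (auto simp: bij_betw_def)
  from this[THEN image_pairs] show ?thesis
    by (simp add: disjoint_union_def complete_graph_def)
qed

text \<open>A copy of \<open>2K\<^sub>r\<close> is just a pair of disjoint vertex sets that are cliques, since subgraphs need
  not be induced: edges between the two cliques do not matter.\<close>

lemma free_of_two_cliques_iff:
  assumes "simple_graph G"
  shows "free_of (disjoint_union (complete_graph r) (complete_graph r)) G \<longleftrightarrow>
    pairwise_meeting (cliques (verts G) (edges G) r)"
proof
  assume free: "free_of (disjoint_union (complete_graph r) (complete_graph r)) G"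
  show "pairwise_meeting (cliques (verts G) (edges G) r)"
  proof (intro ballI notI)
    fix A B assume A: "A \<in> cliques (verts G) (edges G) r" and B: "B \<in> cliques (verts G) (edges G) r"
      and disj: "A \<inter> B = {}"
    have fin: "finite A" "finite B"
      using A B assms by (auto simp: cliques_def simple_graph_def dest: finite_subset)
    obtain g where g: "bij_betw g {..<r} A"
      using ex_bij_betw_nat_finite[OF fin(1)] A by (auto simp: cliques_def atLeast0LessThan)
    obtain h where h: "bij_betw h {..<r} B"
      using ex_bij_betw_nat_finite[OF fin(2)] B by (auto simp: cliques_def atLeast0LessThan)
    define f where "f = case_sum g h"
    define S where "S = \<lparr>verts = A \<union> B, edges = pairs A \<union> pairs B\<rparr>"
    have fA: "bij_betw f (Inl ` {..<r}) A" and fB: "bij_betw f (Inr ` {..<r}) B"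
      using g h by (auto simp: f_def bij_betw_def inj_on_def image_image)
    have "bij_betw f (Inl ` {..<r} \<union> Inr ` {..<r}) (A \<union> B)"
      using bij_betw_combine[OF fA fB disj] .
    then have "isomorphic (disjoint_union (complete_graph r) (complete_graph r)) S"
      unfolding isomorphic_def verts_disjoint_union_complete edges_disjoint_union_complete
      using image_pairs[OF fA] image_pairs[OF fB]
      by (intro exI[of _ f]) (simp add: S_def image_Un)
    moreover have "subgraph S G"
      using A B fin
      by (auto simp: subgraph_def simple_graph_def S_def cliques_def is_clique_iff_pairs)
    ultimately show False using free by (auto simp: free_of_def)
  qed
next
  assume meet: "pairwise_meeting (cliques (verts G) (edges G) r)"
  show "free_of (disjoint_union (complete_graph r) (complete_graph r)) G"
    unfolding free_of_def
  proof
    assume "\<exists>S. subgraph S G \<and> isomorphic (disjoint_union (complete_graph r) (complete_graph r)) S"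
    then obtain S f where S: "subgraph S G"
      and f: "bij_betw f (Inl ` {..<r} \<union> Inr ` {..<r}) (verts S)"
      and e: "edges S = (\<lambda>e. f ` e) ` (pairs (Inl ` {..<r}) \<union> pairs (Inr ` {..<r}))"
      unfolding isomorphic_def verts_disjoint_union_complete edges_disjoint_union_complete
      by blast
    define A B where "A = f ` Inl ` {..<r}" and "B = f ` Inr ` {..<r}"
    have inj: "inj_on f (Inl ` {..<r} \<union> Inr ` {..<r})" and V: "verts S = A \<union> B"
      using f unfolding bij_betw_def A_def B_def by (simp_all add: image_Un)
    have bA: "bij_betw f (Inl ` {..<r}) A" and bB: "bij_betw f (Inr ` {..<r}) B"
      using inj by (auto simp: bij_betw_def A_def B_def inj_on_Un)
    have "edges S = pairs A \<union> pairs B"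
      unfolding e image_Un image_pairs[OF bA] image_pairs[OF bB] ..
    moreover have "card A = r" "card B = r"
      using bij_betw_same_card[OF bA] bij_betw_same_card[OF bB] by (simp_all add: card_image)
    ultimately have "A \<in> cliques (verts G) (edges G) r" "B \<in> cliques (verts G) (edges G) r"
      using S V by (auto simp: cliques_def subgraph_def is_clique_iff_pairs)
    moreover have "A \<inter> B = {}"
    proof -
      have "f ` Inl ` {..<r} \<inter> f ` Inr ` {..<r} = f ` (Inl ` {..<r} \<inter> Inr ` {..<r})"
        by (rule inj_on_image_Int[OF inj, symmetric]) auto
      then show ?thesis by (auto simp: A_def B_def)
    qed
    ultimately show False using meet by blast
  qed
qed

text \<open>The extremal numbers are maxima over graphs with exactly n vertices in \<^typ>\<open>nat\<close>, whereas the
  joins live in a sum type and may have fewer vertices (the Turan graph with no parts is empty). The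
  missing vertices are added as isolated ones, which lie in no clique of order at least 2.\<close>

lemma embed_in_nat_graph:
  fixes G :: "'a ugraph"
  assumes G: "simple_graph G" "card (verts G) \<le> n"
  obtains G' :: "nat ugraph" and f :: "'a \<Rightarrow> nat"
  where "simple_graph G'" "card (verts G') = n" "inj_on f (verts G)"
    "\<And>j. j \<ge> 2 \<or> card (verts G) = n \<Longrightarrow>
       cliques (verts G') (edges G') j = (\<lambda>C. f ` C) ` cliques (verts G) (edges G) j"
proof -
  have fin: "finite (verts G)" using G by (simp add: simple_graph_def)
  then obtain f where f: "bij_betw f (verts G) {..<card (verts G)}"
    using ex_bij_betw_finite_nat by (auto simp: atLeast0LessThan)
  then have inj: "inj_on f (verts G)" and im: "f ` verts G = {..<card (verts G)}"
    by (auto simp: bij_betw_def)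
  define G' where "G' = \<lparr>verts = {..<n}, edges = (\<lambda>e. f ` e) ` edges G\<rparr>"
  have edgeV: "e \<subseteq> verts G" "card e = 2" if "e \<in> edges G" for e
    using that G by (auto simp: simple_graph_def)
  have imV: "f ` e \<subseteq> {..<n}" if "e \<subseteq> verts G" for e
    using image_mono[OF that, of f] im G(2) by auto
  have "card (f ` e) = 2" if "e \<in> edges G" for e
    using edgeV[OF that] inj by (auto simp: card_image inj_on_subset)
  then have s': "simple_graph G'"
    using imV edgeV by (auto simp: simple_graph_def G'_def)
  have main: "cliques (verts G') (edges G') j = (\<lambda>C. f ` C) ` cliques (verts G) (edges G) j"
    if j: "j \<ge> 2 \<or> card (verts G) = n" for j
  proof (intro set_eqI iffI)
    fix C assume "C \<in> (\<lambda>C. f ` C) ` cliques (verts G) (edges G) j"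
    then obtain D where D: "C = f ` D" "D \<subseteq> verts G" "card D = j" "is_clique (edges G) D"
      by (auto simp: cliques_def)
    have "is_clique (edges G') C"
      unfolding is_clique_def
    proof (intro ballI impI)
      fix x y assume "x \<in> C" "y \<in> C" "x \<noteq> y"
      then obtain u v where uv: "u \<in> D" "v \<in> D" "x = f u" "y = f v" "u \<noteq> v"
        using D(1) by auto
      then have "{u, v} \<in> edges G" using D(4) by (auto simp: is_clique_def)
      then have "f ` {u, v} \<in> edges G'" unfolding G'_def ugraph.simps by (rule imageI)
      then show "{x, y} \<in> edges G'" using uv by simp
    qed
    moreover have "card C = j" using D inj by (auto simp: card_image inj_on_subset)
    ultimately show "C \<in> cliques (verts G') (edges G') j"
      using D imV by (auto simp: cliques_def G'_def)
  next
    fix C assume C: "C \<in> cliques (verts G') (edges G') j"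
    have "C \<subseteq> f ` verts G"
    proof (cases "card (verts G) = n")
      case True
      then show ?thesis using C im by (simp add: cliques_def G'_def)
    next
      case False
      with j have "j \<ge> 2" by simp
      show ?thesis
      proof
        fix x assume x: "x \<in> C"
        have "\<not> C \<subseteq> {x}"
          using card_mono[of "{x}" C] C \<open>j \<ge> 2\<close> by (auto simp: cliques_def)
        then obtain y where "y \<in> C" "y \<noteq> x" by auto
        then have "{x, y} \<in> edges G'" using C x by (auto simp: cliques_def is_clique_def)
        then obtain e where "e \<in> edges G" "{x, y} = f ` e" by (auto simp: G'_def)
        then show "x \<in> f ` verts G" using edgeV by blast
      qed
    qed
    then obtain D where D: "D \<subseteq> verts G" "C = f ` D"
      by (auto simp: subset_image_iff)
    have "is_clique (edges G) D"
      unfolding is_clique_def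
    proof (intro ballI impI)
      fix u v assume uv: "u \<in> D" "v \<in> D" "u \<noteq> v"
      then have "f u \<noteq> f v" using inj D(1) by (auto simp: inj_on_def)
      then have "f ` {u, v} \<in> edges G'"
        using C D uv by (auto simp: cliques_def is_clique_def)
      then obtain e where e: "e \<in> edges G" "f ` {u, v} = f ` e" by (auto simp: G'_def)
      then have "{u, v} = e"
        using inj_on_image_eq_iff[OF inj, of "{u, v}" e] edgeV[OF e(1)] uv D by auto
      then show "{u, v} \<in> edges G" using e by simp
    qed
    moreover have "card D = j"
      using C D inj by (auto simp: cliques_def card_image inj_on_subset)
    ultimately have "D \<in> cliques (verts G) (edges G) j" using D by (auto simp: cliques_def)
    then show "C \<in> (\<lambda>C. f ` C) ` cliques (verts G) (edges G) j" using D by blast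
  qed
  show thesis
    using that[OF s' _ inj main] by (simp add: G'_def)
qed

section \<open>Cliques of the Turan graph\<close>

abbreviation turan_cliques :: "nat \<Rightarrow> nat \<Rightarrow> nat \<Rightarrow> nat set set" where
  "turan_cliques N s k \<equiv> cliques (verts (turan_graph N s)) (edges (turan_graph N s)) k"

lemma simple_graph_turan: "simple_graph (turan_graph N s)"
  by (auto simp: simple_graph_def turan_graph_def card_2_iff)

lemma finite_verts_turan [simp]: "finite (verts (turan_graph N s))"
  using simple_graph_turan by (simp add: simple_graph_def)

text \<open>The cliques of the Turan graph are the partial transversals of its parts.\<close>

lemma turan_cliques_eq:
  assumes "s > 0"
  shows "turan_cliques N s k = {C. C \<subseteq> {..<N} \<and> card C = k \<and> inj_on (\<lambda>x. x mod s) C}"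
proof -
  have "is_clique (edges (turan_graph N s)) C \<longleftrightarrow> inj_on (\<lambda>x. x mod s) C" if "C \<subseteq> {..<N}" for C
    using that assms
    by (fastforce simp: is_clique_def turan_graph_def inj_on_def doubleton_eq_iff)
  then show ?thesis using assms by (auto simp: cliques_def turan_graph_def)
qed

lemma turan_cliques_card_le:
  assumes "C \<in> turan_cliques N s k"
  shows "k \<le> s"
proof (cases "s = 0")
  case True
  then show ?thesis using assms by (auto simp: cliques_def turan_graph_def)
next
  case False
  then have C: "card C = k" "inj_on (\<lambda>x. x mod s) C"
    using assms by (auto simp: turan_cliques_eq)
  have "card C = card ((\<lambda>x. x mod s) ` C)" using C by (simp add: card_image)
  also have "\<dots> \<le> card {..<s}" using False by (intro card_mono) auto
  finally show ?thesis using C by simp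
qed

lemma turan_cliques_mono: "N \<le> N' \<Longrightarrow> turan_cliques N s k \<subseteq> turan_cliques N' s k"
  unfolding turan_graph_def by (rule cliques_mono) (auto split: if_splits dest: less_le_trans)

text \<open>Every part has at least \<open>N div s\<close> vertices, namely \<open>j * s + i\<close> with \<open>j < N div s\<close> in the part
  of residue i. A choice of one of these from each part in R is a clique with residues R.\<close>

lemma card_turan_cliques_residues:
  assumes "R \<subseteq> {..<s}"
  shows "(N div s) ^ card R
    \<le> card {C \<in> turan_cliques N s (card R). (\<lambda>x. x mod s) ` C = R}" (is "_ \<le> card ?F")
proof (cases "s = 0")
  case True
  then show ?thesis using assms by (auto simp: cliques_0)
next
  case False
  have finR: "finite R" using assms finite_subset by blast
  define \<phi> where "\<phi> g = (\<lambda>i. g i * s + i) ` R" for g :: "nat \<Rightarrow> nat"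
  have res: "(g i * s + i) mod s = i" if "i \<in> R" for g i
    using that assms by auto
  have "\<phi> g \<in> ?F" if g: "g \<in> R \<rightarrow>\<^sub>E {..<N div s}" for g
  proof -
    have "inj_on (\<lambda>i. g i * s + i) R"
    proof (rule inj_onI)
      fix i j assume "i \<in> R" "j \<in> R" "g i * s + i = g j * s + j"
      then show "i = j" using res[of i g] res[of j g] by simp
    qed
    then have "card (\<phi> g) = card R" by (simp add: \<phi>_def card_image)
    moreover have "g i * s + i < N" if "i \<in> R" for i
    proof -
      have "Suc (g i) \<le> N div s" using g that by (auto simp: PiE_iff)
      then have "Suc (g i) * s \<le> N div s * s" by (intro mult_le_mono1)
      also have "\<dots> \<le> N" by simp
      finally show ?thesis using that assms by auto
    qed
    moreover have "inj_on (\<lambda>x. x mod s) (\<phi> g)"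
      using res[of _ g] by (auto simp: \<phi>_def inj_on_def)
    moreover have "(\<lambda>x. x mod s) ` \<phi> g = R"
      unfolding \<phi>_def image_image using res[of _ g] by (simp cong: image_cong_simp)
    ultimately show ?thesis using False by (auto simp: turan_cliques_eq \<phi>_def)
  qed
  moreover have "inj_on \<phi> (R \<rightarrow>\<^sub>E {..<N div s})"
  proof (rule inj_onI)
    fix g h assume g: "g \<in> R \<rightarrow>\<^sub>E {..<N div s}" and h: "h \<in> R \<rightarrow>\<^sub>E {..<N div s}"
      and eq: "\<phi> g = \<phi> h"
    show "g = h"
    proof (rule PiE_ext[OF g h])
      fix i assume i: "i \<in> R"
      then have "g i * s + i \<in> \<phi> h" using eq by (auto simp: \<phi>_def)
      then obtain j where j: "j \<in> R" "g i * s + i = h j * s + j" by (auto simp: \<phi>_def)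
      then have "i = j" using res[OF i, of g] res[OF j(1), of h] by simp
      then show "g i = h i" using j False by simp
    qed
  qed
  ultimately have "card (R \<rightarrow>\<^sub>E {..<N div s}) \<le> card ?F"
    by (intro card_inj_on_le) auto
  then show ?thesis using finR by (simp add: card_PiE)
qed

lemma card_turan_cliques_ge: "(N div s) ^ s \<le> card (turan_cliques N s s)"
proof -
  have "(N div s) ^ s \<le> card {C \<in> turan_cliques N s s. (\<lambda>x. x mod s) ` C = {..<s}}"
    using card_turan_cliques_residues[of "{..<s}" s N] by simp
  also have "\<dots> \<le> card (turan_cliques N s s)" by (intro card_mono) auto
  finally show ?thesis .
qed

text \<open>Adding the vertex N to \<open>T(N, s)\<close> extends only those (k-1)-cliques that avoid the part of N. The
  cliques meeting that part make up the gain when N is joined to all vertices instead; the power on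
  the left bounds their number from below. The hypothesis \<open>2 \<le> k\<close> matters: for \<open>k = 1\<close> the only
  (k-1)-clique is empty and there is no gain.\<close>

lemma card_turan_cliques_Suc:
  assumes "2 \<le> k" "k \<le> s"
  shows "card (turan_cliques (Suc N) s k) + (N div s) ^ (k - 1)
    \<le> card (turan_cliques N s k) + card (turan_cliques N s (k - 1))"
proof -
  have s: "s > 0" using assms by simp
  define \<rho> where "\<rho> = N mod s"
  define \<T> where "\<T> = turan_cliques N s (k - 1)"
  \<comment> \<open>the (k-1)-cliques that N can extend, and those that it cannot\<close>
  define \<T>0 where "\<T>0 = {C \<in> \<T>. \<rho> \<notin> (\<lambda>x. x mod s) ` C}"
  define \<T>1 where "\<T>1 = {C \<in> \<T>. \<rho> \<in> (\<lambda>x. x mod s) ` C}"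
  have fin: "finite \<T>" by (simp add: \<T>_def)
  have "C \<in> turan_cliques N s k \<union> insert N ` \<T>0" if C: "C \<in> turan_cliques (Suc N) s k" for C
  proof (cases "N \<in> C")
    case True
    have C': "C \<subseteq> {..<Suc N}" "card C = k" "inj_on (\<lambda>x. x mod s) C"
      using C s by (auto simp: turan_cliques_eq)
    have "finite C" using C'(1) finite_subset by blast
    then have "C - {N} \<in> \<T>"
      using C' True s by (auto simp: turan_cliques_eq \<T>_def less_Suc_eq inj_on_diff)
    moreover have "\<rho> \<notin> (\<lambda>x. x mod s) ` (C - {N})"
      using C'(3) True by (auto simp: \<rho>_def inj_on_def)
    moreover have "C = insert N (C - {N})" using True by auto
    ultimately show ?thesis unfolding \<T>0_def by blast
  next
    case False
    then show ?thesis using C s by (auto simp: turan_cliques_eq less_Suc_eq)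
  qed
  then have "card (turan_cliques (Suc N) s k) \<le> card (turan_cliques N s k \<union> insert N ` \<T>0)"
    using fin by (intro card_mono) (auto simp: \<T>0_def)
  also have "\<dots> \<le> card (turan_cliques N s k) + card (insert N ` \<T>0)"
    by (rule card_Un_le)
  also have "\<dots> \<le> card (turan_cliques N s k) + card \<T>0"
    using fin by (intro add_left_mono card_image_le) (auto simp: \<T>0_def)
  finally have 1: "card (turan_cliques (Suc N) s k) \<le> card (turan_cliques N s k) + card \<T>0" .
  have "\<rho> < s" using s by (simp add: \<rho>_def)
  \<comment> \<open>to count the latter, fix any set R of k-1 parts that includes the part of N\<close>
  have "k - 2 \<le> card ({..<s} - {\<rho>})" using assms s \<open>\<rho> < s\<close> by simp
  then obtain R' where R': "R' \<subseteq> {..<s} - {\<rho>}" "card R' = k - 2" "finite R'"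
    using obtain_subset_with_card_n by metis
  define R where "R = insert \<rho> R'"
  have cR: "card R = k - 1"
  proof -
    have "\<rho> \<notin> R'" using R' by auto
    then show ?thesis using R' assms by (simp add: R_def)
  qed
  moreover have "R \<subseteq> {..<s}" using R' \<open>\<rho> < s\<close> by (auto simp: R_def)
  ultimately have "(N div s) ^ (k - 1) \<le> card {C \<in> \<T>. (\<lambda>x. x mod s) ` C = R}"
    using card_turan_cliques_residues[of R s N] by (simp add: \<T>_def)
  also have "\<dots> \<le> card \<T>1" using fin by (intro card_mono) (auto simp: \<T>1_def R_def)
  finally have 2: "(N div s) ^ (k - 1) \<le> card \<T>1" .
  have "card \<T>0 + card \<T>1 = card (\<T>0 \<union> \<T>1)"
    using fin by (intro card_Un_disjoint[symmetric]) (auto simp: \<T>0_def \<T>1_def)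
  also have "\<T>0 \<union> \<T>1 = \<T>" by (auto simp: \<T>0_def \<T>1_def)
  finally show ?thesis using 1 2 by (simp add: \<T>_def)
qed

section \<open>Zykov's theorem\<close>

text \<open>The proof removes an s-clique A and inducts. A j-clique D outside A extends to k-cliques by
  choosing \<open>k - j\<close> of its common neighbours in A. In a graph without (s+1)-cliques there are at most
  \<open>s - j\<close> such neighbours, because together with D they form a clique; in the Turan graph, with A
  consisting of one vertex from each part, there are exactly \<open>s - j\<close>. So the same recursion holds
  with \<open>\<le>\<close> in general and with equality for the Turan graph.\<close>

lemma card_cliques_le_split:
  assumes fin: "finite V" and A: "A \<subseteq> V"
    and few: "\<And>D. D \<subseteq> V - A \<Longrightarrow> is_clique E D \<Longrightarrow> card {v \<in> A. \<forall>d\<in>D. {d, v} \<in> E} \<le> s - card D"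
  shows "card (cliques V E k)
    \<le> (\<Sum>j\<le>k. card (cliques (V - A) E j) * ((s - j) choose (k - j)))"
proof -
  define N where "N D = {v \<in> A. \<forall>d\<in>D. {d, v} \<in> E}" for D
  define I where "I = Sigma {..k} (\<lambda>j. Sigma (cliques (V - A) E j) (\<lambda>D. {S. S \<subseteq> N D \<and> card S = k - j}))"
  have finA: "finite A" using fin A finite_subset by blast
  have finN: "finite (N D)" for D using finA by (simp add: N_def)
  have finS: "finite {S. S \<subseteq> N D \<and> card S = i}" for D i
    using finN[of D] by simp
  have "C \<in> (\<lambda>(j, D, S). D \<union> S) ` I" if C: "C \<in> cliques V E k" for C
  proof -
    have C': "C \<subseteq> V" "card C = k" "is_clique E C" "finite C"
      using C fin by (auto simp: cliques_def dest: finite_subset)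
    define D S where "D = C - A" and "S = C \<inter> A"
    have "card C = card D + card S" unfolding D_def S_def
      using C'(4) by (subst card_Un_disjoint[symmetric]) (auto intro: arg_cong[of _ _ card])
    moreover have "D \<in> cliques (V - A) E (card D)"
      using C' by (auto simp: cliques_def D_def intro: is_clique_subset)
    moreover have "S \<subseteq> N D"
      using C'(3) by (auto simp: N_def S_def D_def is_clique_def)
    ultimately have "(card D, D, S) \<in> I"
      using C'(2) by (auto simp: I_def)
    moreover have "C = D \<union> S" by (auto simp: D_def S_def)
    ultimately show ?thesis by (intro image_eqI[of _ _ "(card D, D, S)"]) simp_all
  qed
  then have "cliques V E k \<subseteq> (\<lambda>(j, D, S). D \<union> S) ` I" by blast
  moreover have finI: "finite I"
    unfolding I_def using fin finS by (intro finite_SigmaI) auto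
  ultimately have "card (cliques V E k) \<le> card I"
    by (meson card_image_le card_mono finite_imageI order_trans)
  also have "\<dots> = (\<Sum>j\<le>k. \<Sum>D\<in>cliques (V - A) E j. card (N D) choose (k - j))"
    unfolding I_def using fin finS finN by (simp add: card_SigmaI n_subsets)
  also have "\<dots> \<le> (\<Sum>j\<le>k. \<Sum>D\<in>cliques (V - A) E j. (s - j) choose (k - j))"
  proof (intro sum_mono)
    fix j D assume "D \<in> cliques (V - A) E j"
    then have "card (N D) \<le> s - j"
      using few[of D] by (auto simp: cliques_def N_def)
    then show "card (N D) choose (k - j) \<le> (s - j) choose (k - j)"
      by (rule binomial_right_mono)
  qed
  finally show ?thesis by simp
qed

text \<open>The last s vertices of \<open>T(M + s, s)\<close> meet every part once and so play the role of A; the others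
  induce \<open>T(M, s)\<close>.\<close>

lemma card_turan_cliques_split:
  assumes s: "s > 0"
  shows "(\<Sum>j\<le>k. card (turan_cliques M s j) * ((s - j) choose (k - j)))
    \<le> card (turan_cliques (M + s) s k)"
proof -
  define A where "A = {M..<M + s}"
  have injA: "inj_on (\<lambda>x. x mod s) A"
  proof (rule inj_onI)
    have "x = y" if "x \<in> A" "y \<in> A" "x \<le> y" "x mod s = y mod s" for x y
    proof -
      have "s dvd y - x" using that by (metis mod_eq_dvd_iff_nat)
      moreover have "y - x < s" using that by (auto simp: A_def)
      ultimately show ?thesis using that by (auto dest: dvd_imp_le)
    qed
    then show "x = y" if "x \<in> A" "y \<in> A" "x mod s = y mod s" for x y
      using that by (metis nat_le_linear)
  qed
  have "card ((\<lambda>x. x mod s) ` A) = s" using injA by (simp add: card_image A_def)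
  then have imA: "(\<lambda>x. x mod s) ` A = {..<s}"
    using s by (intro card_subset_eq) auto
  define N where "N D = {v \<in> A. v mod s \<notin> (\<lambda>x. x mod s) ` D}" for D
  define I where "I = Sigma {..k} (\<lambda>j. Sigma (turan_cliques M s j) (\<lambda>D. {S. S \<subseteq> N D \<and> card S = k - j}))"
  have finN: "finite (N D)" for D by (simp add: N_def A_def)
  have finS: "finite {S. S \<subseteq> N D \<and> card S = i}" for D i
    using finN[of D] by simp
  have cardN: "card (N D) = s - j" if D: "D \<in> turan_cliques M s j" for D j
  proof -
    have D': "card D = j" "inj_on (\<lambda>x. x mod s) D" "finite D"
      using D s by (auto simp: turan_cliques_eq intro: finite_subset[of _ "{..<M}"])
    have "(\<lambda>x. x mod s) ` N D = {..<s} - (\<lambda>x. x mod s) ` D"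
      using imA by (auto simp: N_def)
    moreover have "inj_on (\<lambda>x. x mod s) (N D)"
      using injA by (rule inj_on_subset) (auto simp: N_def)
    ultimately have "card (N D) = card ({..<s} - (\<lambda>x. x mod s) ` D)"
      by (metis card_image)
    also have "\<dots> = s - card D"
      using D' s by (subst card_Diff_subset) (auto simp: card_image)
    finally show ?thesis using D' by simp
  qed
  have I_D: "D \<subseteq> {..<M}" "card D = j" "inj_on (\<lambda>x. x mod s) D" "S \<subseteq> N D" "card S = k - j" "j \<le> k" "S \<subseteq> A"
    if "(j, D, S) \<in> I" for j D S
    using that s by (auto simp: I_def turan_cliques_eq N_def)
  have "D \<union> S \<in> turan_cliques (M + s) s k" if I: "(j, D, S) \<in> I" for j D S
  proof -
    note DS = I_D[OF I]
    have "finite D" "finite S" using DS finN finite_subset by blast+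
    moreover have "D \<inter> S = {}"
    proof -
      have "{..<M} \<inter> A = {}" by (auto simp: A_def)
      then show ?thesis using DS(1,7) by blast
    qed
    ultimately have "card (D \<union> S) = k" using DS by (simp add: card_Un_disjoint)
    moreover have "inj_on (\<lambda>x. x mod s) (D \<union> S)"
    proof -
      have "u mod s \<noteq> v mod s" if "u \<in> D" "v \<in> S" for u v
      proof -
        have "v mod s \<notin> (\<lambda>x. x mod s) ` D" using DS(4) that(2) by (auto simp: N_def)
        moreover have "u mod s \<in> (\<lambda>x. x mod s) ` D" using that(1) by (rule imageI)
        ultimately show ?thesis by metis
      qed
      then have "(\<lambda>x. x mod s) ` (D - S) \<inter> (\<lambda>x. x mod s) ` (S - D) = {}"
        by blast
      then show ?thesis
        unfolding inj_on_Un using DS(3) inj_on_subset[OF injA DS(7)] by simp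
    qed
    moreover have "D \<union> S \<subseteq> {..<M + s}" using DS by (force simp: A_def)
    ultimately show ?thesis using s by (simp add: turan_cliques_eq)
  qed
  then have "(\<lambda>(j, D, S). D \<union> S) ` I \<subseteq> turan_cliques (M + s) s k" by auto
  moreover have "inj_on (\<lambda>(j, D, S). D \<union> S) I"
  proof (rule inj_onI)
    fix x y assume xy: "x \<in> I" "y \<in> I" "(case x of (j, D, S) \<Rightarrow> D \<union> S) = (case y of (j, D, S) \<Rightarrow> D \<union> S)"
    obtain j D S j' D' S' where x: "x = (j, D, S)" and y: "y = (j', D', S')"
      by (metis prod_cases3)
    have I: "(j, D, S) \<in> I" "(j', D', S') \<in> I" and eq: "D \<union> S = D' \<union> S'"
      using xy x y by auto
    note DS = I_D[OF I(1)] I_D[OF I(2)]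
    have "D = (D \<union> S) \<inter> {..<M}" "D' = (D' \<union> S') \<inter> {..<M}"
      "S = (D \<union> S) \<inter> A" "S' = (D' \<union> S') \<inter> A"
      using DS by (auto simp: A_def)
    then have "D = D'" "S = S'" using eq by simp_all
    then show "x = y" using DS x y by simp
  qed
  ultimately have "card I \<le> card (turan_cliques (M + s) s k)"
    by (intro card_inj_on_le) auto
  moreover have "card I = (\<Sum>j\<le>k. \<Sum>D\<in>turan_cliques M s j. card (N D) choose (k - j))"
    unfolding I_def using finS finN by (simp add: card_SigmaI n_subsets)
  moreover have "\<dots> = (\<Sum>j\<le>k. card (turan_cliques M s j) * ((s - j) choose (k - j)))"
    using cardN by (intro sum.cong) simp_all
  ultimately show ?thesis by simp
qed

text \<open>The induction needs an s-clique to remove. Take an edge-maximal supergraph without (s+1)-cliques: if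
  it had no s-clique, it would not be complete, and adding a missing edge xy would create an
  (s+1)-clique, which minus x is an s-clique that does not use the new edge.\<close>

lemma exists_supergraph_with_clique:
  assumes fin: "finite V" and free: "cliques V E (Suc s) = {}" and large: "s \<le> card V"
  obtains E' where "E \<subseteq> E'" "cliques V E' (Suc s) = {}" "cliques V E' s \<noteq> {}"
proof -
  define \<X> where "\<X> = {X \<in> Pow (Pow V). cliques V (E \<union> X) (Suc s) = {}}"
  have "finite \<X>" "{} \<in> \<X>" using fin free by (auto simp: \<X>_def)
  then obtain X where X: "X \<in> \<X>" and max: "\<And>Y. Y \<in> \<X> \<Longrightarrow> X \<subseteq> Y \<Longrightarrow> X = Y"
    using finite_has_maximal[of \<X>] by blast
  have "cliques V (E \<union> X) s \<noteq> {}"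
  proof
    assume none: "cliques V (E \<union> X) s = {}"
    obtain C where C: "C \<subseteq> V" "card C = s" using large obtain_subset_with_card_n by metis
    then have "\<not> is_clique (E \<union> X) C" using none by (auto simp: cliques_def)
    then obtain x y where xy: "x \<in> V" "y \<in> V" "x \<noteq> y" "{x, y} \<notin> E \<union> X"
      using C by (auto simp: is_clique_def)
    have "insert {x, y} X \<notin> \<X>" using max[of "insert {x, y} X"] xy by auto
    then have "cliques V (E \<union> insert {x, y} X) (Suc s) \<noteq> {}"
      using X xy by (auto simp: \<X>_def)
    then obtain K where K: "K \<subseteq> V" "card K = Suc s" "is_clique (E \<union> insert {x, y} X) K"
      by (auto simp: cliques_def)
    have "s \<le> card (K - {x})" using K by (simp add: card_Diff_singleton_if)
    then obtain L where L: "L \<subseteq> K - {x}" "card L = s" using obtain_subset_with_card_n by metis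
    have "is_clique (E \<union> X) L"
      using K(3) L(1) by (fastforce simp: is_clique_def doubleton_eq_iff)
    then have "L \<in> cliques V (E \<union> X) s" using K L by (auto simp: cliques_def)
    then show False using none by simp
  qed
  then show thesis using that[of "E \<union> X"] X by (auto simp: \<X>_def)
qed

text \<open>Below s vertices the Turan graph is complete, which starts the induction.\<close>

theorem zykov:
  assumes "finite V" "cliques V E (Suc s) = {}"
  shows "card (cliques V E k) \<le> card (turan_cliques (card V) s k)"
  using assms
proof (induction "card V" arbitrary: V E k rule: less_induct)
  case less
  show ?case
  proof (cases "s = 0")
    case True
    then have "V = {}" using less.prems(2) cliques_1[of V E] by simp
    then show ?thesis using True by (simp add: turan_graph_def cliques_empty_verts)
  next
    case s: False
    show ?thesis
    proof (cases "card V < s")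
      case True
      have "card (cliques V E k) \<le> card {C. C \<subseteq> V \<and> card C = k}"
        using less.prems by (intro card_mono) (auto simp: cliques_def)
      also have "\<dots> = card V choose k" using less.prems by (simp add: n_subsets)
      also have "\<dots> = card {C. C \<subseteq> {..<card V} \<and> card C = k}" by (simp add: n_subsets)
      also have "\<dots> \<le> card (turan_cliques (card V) s k)"
      proof (intro card_mono subsetI)
        fix C assume C: "C \<in> {C. C \<subseteq> {..<card V} \<and> card C = k}"
        then have "x mod s = x" if "x \<in> C" for x using that True by auto
        then have "inj_on (\<lambda>x. x mod s) C" by (auto simp: inj_on_def)
        then show "C \<in> turan_cliques (card V) s k" using C s by (simp add: turan_cliques_eq)
      qed simp
      finally show ?thesis .
    next
      case False
      then have "s \<le> card V" by simp
      from exists_supergraph_with_clique[OF less.prems this] obtain E'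
        where E': "E \<subseteq> E'" "cliques V E' (Suc s) = {}" and "cliques V E' s \<noteq> {}" .
      then obtain A where A: "A \<in> cliques V E' s" by blast
      have A': "A \<subseteq> V" "card A = s" "is_clique E' A" using A by (auto simp: cliques_def)
      have finA: "finite A" using A' less.prems(1) finite_subset by blast
      have cardU: "card (V - A) = card V - s" using A' finA by (simp add: card_Diff_subset)
      have freeU: "cliques (V - A) E' (Suc s) = {}"
        using E'(2) cliques_mono[of "V - A" V E' E' "Suc s"] by auto
      have "card (cliques V E k) \<le> card (cliques V E' k)"
        using E' less.prems by (intro card_mono cliques_mono) auto
      also have "\<dots> \<le> (\<Sum>j\<le>k. card (cliques (V - A) E' j) * ((s - j) choose (k - j)))"
      proof (rule card_cliques_le_split[OF less.prems(1) A'(1)])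
        fix D assume D: "D \<subseteq> V - A" "is_clique E' D"
        define S where "S = {v \<in> A. \<forall>d\<in>D. {d, v} \<in> E'}"
        have SA: "S \<subseteq> A" by (auto simp: S_def)
        have "is_clique E' (D \<union> S)"
          unfolding is_clique_Un using D is_clique_subset[OF A'(3) SA] by (auto simp: S_def)
        moreover have "D \<union> S \<subseteq> V" using D SA A' by blast
        ultimately have "cliques V E' (card (D \<union> S)) \<noteq> {}" by (auto simp: cliques_def)
        then have "\<not> Suc s \<le> card (D \<union> S)"
          using cliques_empty_larger[OF less.prems(1) E'(2)] by blast
        moreover have "card (D \<union> S) = card D + card S"
          using D SA finA less.prems(1)
          by (intro card_Un_disjoint) (auto intro: finite_subset)
        ultimately show "card {v \<in> A. \<forall>d\<in>D. {d, v} \<in> E'} \<le> s - card D"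
          by (simp add: S_def)
      qed
      also have "\<dots> \<le> (\<Sum>j\<le>k. card (turan_cliques (card V - s) s j) * ((s - j) choose (k - j)))"
      proof (intro sum_mono mult_right_mono)
        fix j
        have "card (V - A) < card V" using cardU s False by simp
        from less.hyps[OF this _ freeU, of j]
        show "card (cliques (V - A) E' j) \<le> card (turan_cliques (card V - s) s j)"
          using less.prems(1) cardU by simp
      qed simp
      also have "\<dots> \<le> card (turan_cliques (card V - s + s) s k)"
        using s by (intro card_turan_cliques_split) simp
      finally show ?thesis using False by simp
    qed
  qed
qed

section \<open>Intersecting families\<close>

text \<open>Fix one member A. Every member meets A in at least m elements, hence contains an m-subset M of A; for
  each M there is a member \<open>c M\<close> not containing M, and meeting \<open>c M\<close> in m elements too forces an
  element of \<open>c M - M\<close>. So M together with an element of \<open>c M - M\<close> works, and the number of such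
  sets is bounded independently of the ground set.\<close>

lemma intersecting_kernel:
  assumes size: "\<And>C. C \<in> \<F> \<Longrightarrow> finite C \<and> card C = k"
    and meet: "\<And>A B. A \<in> \<F> \<Longrightarrow> B \<in> \<F> \<Longrightarrow> m \<le> card (A \<inter> B)"
    and nontrivial: "\<And>M. finite M \<Longrightarrow> card M = m \<Longrightarrow> \<exists>C\<in>\<F>. \<not> M \<subseteq> C"
  obtains P where "finite P" "card P \<le> 2 ^ k * k"
    "\<And>S. S \<in> P \<Longrightarrow> finite S \<and> card S = Suc m" "\<And>C. C \<in> \<F> \<Longrightarrow> \<exists>S\<in>P. S \<subseteq> C"
proof (cases "\<F> = {}")
  case True
  then show thesis using that[of "{}"] by simp
next
  case False
  then obtain A where A: "A \<in> \<F>" by blast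
  have finA: "finite A" and cardA: "card A = k" using size[OF A] by auto
  define \<M> where "\<M> = {M. M \<subseteq> A \<and> card M = m}"
  have finM: "finite M" "card M = m" if "M \<in> \<M>" for M
    using that finite_subset[OF _ finA] by (auto simp: \<M>_def)
  define c where "c M = (SOME C. C \<in> \<F> \<and> \<not> M \<subseteq> C)" for M
  have c: "c M \<in> \<F>" "\<not> M \<subseteq> c M" if "M \<in> \<M>" for M
  proof -
    have "\<exists>C. C \<in> \<F> \<and> \<not> M \<subseteq> C" using nontrivial[OF finM[OF that]] by blast
    from someI_ex[OF this] show "c M \<in> \<F>" "\<not> M \<subseteq> c M" by (auto simp: c_def)
  qed
  define I where "I = Sigma \<M> (\<lambda>M. c M - M)"
  have "\<M> \<subseteq> Pow A" by (auto simp: \<M>_def)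
  then have fin\<M>: "finite \<M>" and card\<M>: "card \<M> \<le> 2 ^ k"
    using finA cardA card_mono[of "Pow A" \<M>] finite_subset[of \<M> "Pow A"] by (auto simp: card_Pow)
  have finI: "finite I"
    unfolding I_def using fin\<M> c size by (intro finite_SigmaI) auto
  have "card I = (\<Sum>M\<in>\<M>. card (c M - M))"
    unfolding I_def using fin\<M> c size by (intro card_SigmaI) auto
  also have "\<dots> \<le> (\<Sum>M\<in>\<M>. k)"
  proof (rule sum_mono)
    fix M assume "M \<in> \<M>"
    then show "card (c M - M) \<le> k"
      using size[OF c(1)] card_mono[of "c M" "c M - M"] by auto
  qed
  also have "\<dots> \<le> 2 ^ k * k" using card\<M> by simp
  finally have cardI: "card I \<le> 2 ^ k * k" .
  define P where "P = (\<lambda>(M, x). insert x M) ` I"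
  show thesis
  proof (rule that)
    show "finite P" using finI by (simp add: P_def)
    show "card P \<le> 2 ^ k * k" using card_image_le[OF finI] cardI unfolding P_def by (rule order_trans)
  next
    fix S assume "S \<in> P"
    then show "finite S \<and> card S = Suc m" using finM by (auto simp: P_def I_def)
  next
    fix C assume C: "C \<in> \<F>"
    obtain M where M: "M \<subseteq> C \<inter> A" "card M = m"
      using obtain_subset_with_card_n[OF meet[OF C A]] by blast
    then have "M \<in> \<M>" by (auto simp: \<M>_def)
    have "card (M \<inter> c M) < card M"
      using c(2)[OF \<open>M \<in> \<M>\<close>] finM[OF \<open>M \<in> \<M>\<close>] by (intro psubset_card_mono) auto
    also have "\<dots> \<le> card (C \<inter> c M)"
      using M meet[OF C c(1)[OF \<open>M \<in> \<M>\<close>]] by simp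
    finally have "\<not> C \<inter> c M \<subseteq> M \<inter> c M"
      using finM[OF \<open>M \<in> \<M>\<close>] by (meson card_mono finite_Int leD)
    then obtain x where "x \<in> C" "x \<in> c M" "x \<notin> M" by blast
    then have "insert x M \<in> P" "insert x M \<subseteq> C"
      using \<open>M \<in> \<M>\<close> M by (auto simp: P_def I_def)
    then show "\<exists>S\<in>P. S \<subseteq> C" by blast
  qed
qed

text \<open>With the family P bounded, this gives an upper bound of order \<open>n\<^bsup>k-p\<^esup>\<close>, the form in which the
  degenerate cases are shown to be negligible.\<close>

lemma card_supersets_le:
  assumes fin: "finite V" "finite P" and P: "\<And>S. S \<in> P \<Longrightarrow> finite S \<and> card S = p"
  shows "card {C. C \<subseteq> V \<and> card C = k \<and> (\<exists>S\<in>P. S \<subseteq> C)} \<le> card P * card V ^ (k - p)"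
proof -
  define R where "R = {D. D \<subseteq> V \<and> card D = k - p}"
  have finR: "finite R" using fin by (simp add: R_def)
  have "C \<in> (\<lambda>(S, D). S \<union> D) ` (P \<times> R)" if C: "C \<subseteq> V" "card C = k" "S \<in> P" "S \<subseteq> C" for C S
  proof -
    have "C - S \<in> R" using C P by (auto simp: R_def card_Diff_subset)
    moreover have "C = S \<union> (C - S)" using C by auto
    ultimately show ?thesis using C(3) by (intro image_eqI[of _ _ "(S, C - S)"]) simp_all
  qed
  then have "{C. C \<subseteq> V \<and> card C = k \<and> (\<exists>S\<in>P. S \<subseteq> C)} \<subseteq> (\<lambda>(S, D). S \<union> D) ` (P \<times> R)"
    by blast
  then have "card {C. C \<subseteq> V \<and> card C = k \<and> (\<exists>S\<in>P. S \<subseteq> C)} \<le> card (P \<times> R)"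
    using fin finR by (meson card_image_le card_mono finite_SigmaI finite_imageI order_trans)
  also have "\<dots> = card P * (card V choose (k - p))"
    using fin by (simp add: card_cartesian_product R_def n_subsets)
  also have "card V choose (k - p) \<le> card V ^ (k - p)"
    by (cases "k - p \<le> card V") (simp_all add: binomial_le_pow binomial_eq_0)
  finally show ?thesis by simp
qed

text \<open>If the union had at least 2r vertices, one could choose r vertices of A while leaving r vertices of
  B: use vertices of \<open>A - B\<close> first, and take from \<open>A \<inter> B\<close> only what is still needed.\<close>

lemma card_Un_cliques_less:
  assumes fin: "finite V" and meet: "pairwise_meeting (cliques V E r)"
    and A: "A \<in> cliques V E a" "r \<le> a" and B: "B \<in> cliques V E b" "r \<le> b"
  shows "card (A \<union> B) < 2 * r"
proof (rule ccontr)
  assume large: "\<not> card (A \<union> B) < 2 * r"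
  have A': "A \<subseteq> V" "card A = a" "is_clique E A" "finite A"
    and B': "B \<subseteq> V" "card B = b" "is_clique E B" "finite B"
    using A B fin by (auto simp: cliques_def dest: finite_subset)
  obtain R where R: "R \<subseteq> A" "card R = r" "r \<le> card (B - R)"
  proof (cases "r \<le> card (A - B)")
    case True
    then obtain R where "R \<subseteq> A - B" "card R = r" using obtain_subset_with_card_n by metis
    moreover from this have "B - R = B" by auto
    ultimately show thesis using that[of R] B B' by auto
  next
    case False
    \<comment> \<open>all of \<open>A - B\<close> goes into R, so B loses only what the whole union loses\<close>
    have "card A = card (A - B) + card (A \<inter> B)"
      using A' by (subst card_Un_disjoint[symmetric]) (auto intro: arg_cong[of _ _ card])
    then have "r - card (A - B) \<le> card (A \<inter> B)" using A' A(2) by simp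
    then obtain Z where Z: "Z \<subseteq> A \<inter> B" "card Z = r - card (A - B)"
      using obtain_subset_with_card_n by metis
    define R where "R = (A - B) \<union> Z"
    have "finite Z" using Z A' finite_subset by blast
    then have "card R = r"
      unfolding R_def using Z A' False by (subst card_Un_disjoint) auto
    moreover have "R \<subseteq> A" using Z by (auto simp: R_def)
    moreover have "B - R = (A \<union> B) - R" using Z by (auto simp: R_def)
    moreover have "card ((A \<union> B) - R) = card (A \<union> B) - r"
      using \<open>R \<subseteq> A\<close> \<open>card R = r\<close> A' by (subst card_Diff_subset) (auto intro: finite_subset)
    ultimately show thesis using that[of R] large by simp
  qed
  obtain T where T: "T \<subseteq> B - R" "card T = r" using R(3) obtain_subset_with_card_n by metis
  have "R \<in> cliques V E r" "T \<in> cliques V E r"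
    using R T A' B' by (auto simp: cliques_def intro: is_clique_subset)
  moreover have "R \<inter> T = {}" using T by auto
  ultimately show False using meet by blast
qed

section \<open>Graphs without two disjoint cliques of order r\<close>

text \<open>The part of the theorem with \<open>k < r\<close>, for \<open>r = s + 1\<close> and \<open>n = N + 1\<close>. The right-hand side counts
  the k-cliques of \<open>K\<^sub>1 \<or> T(N, s)\<close> according to whether they contain the extra vertex. The hypothesis
  \<open>large\<close> says that n is large enough for the loss of \<open>O(n\<^bsup>k-2\<^esup>)\<close> cliques to be below the gain in
  \<open>card_turan_cliques_Suc\<close>.\<close>

lemma card_small_cliques_le:
  assumes fin: "finite V" and cardV: "card V = Suc N"
    and meet: "pairwise_meeting (cliques V E (Suc s))"
    and k: "1 \<le> k" "k \<le> s"
    and large: "2 \<le> k \<Longrightarrow> 2 ^ Suc s * Suc s * Suc N ^ (k - 2) \<le> (N div s) ^ (k - 1)"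
  shows "card (cliques V E k) \<le> card (turan_cliques N s k) + card (turan_cliques N s (k - 1))"
proof (cases "k = 1")
  case True
  have "card (turan_cliques N s 1) = N"
    unfolding card_cliques_1 using k by (auto simp: turan_graph_def)
  moreover have "card (cliques V E 1) = Suc N" by (simp only: card_cliques_1 cardV)
  ultimately show ?thesis using True by (simp add: cliques_0)
next
  case False
  then have k2: "2 \<le> k" using k by simp
  show ?thesis
  proof (cases "\<exists>v\<in>V. cliques (V - {v}) E (Suc s) = {}")
    case True
    then obtain v where v: "v \<in> V" "cliques (V - {v}) E (Suc s) = {}" by blast
    have "card (V - {v}) = N" using v cardV by simp
    then have "card (cliques (V - {v}) E j) \<le> card (turan_cliques N s j)" for j
      using zykov[of "V - {v}" E s j] fin v by simp
    then show ?thesis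
      using card_cliques_remove_vertex[OF fin k(1), of E v] by (meson add_mono order_trans)
  next
    case False
    let ?\<F> = "cliques V E (Suc s)"
    have nontrivial: "\<exists>C\<in>?\<F>. \<not> M \<subseteq> C" if "finite M" "card M = 1" for M
    proof -
      obtain v where v: "M = {v}" using \<open>card M = 1\<close> by (auto simp: card_1_singleton_iff)
      \<comment> \<open>if v is not a vertex at all, any r-clique avoids it; one is obtained by deleting some vertex w\<close>
      have "\<exists>w\<in>V. v \<in> V \<longrightarrow> w = v" using cardV by (metis card.empty equals0I nat.distinct(1))
      then obtain w where w: "w \<in> V" "v \<in> V \<longrightarrow> w = v" by blast
      then obtain C where "C \<in> cliques (V - {w}) E (Suc s)" using False by blast
      then have "C \<in> ?\<F>" "v \<notin> C" using w by (auto simp: cliques_def)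
      then show ?thesis using v by auto
    qed
    have meet': "1 \<le> card (A \<inter> B)" if "A \<in> ?\<F>" "B \<in> ?\<F>" for A B
    proof -
      have "finite (A \<inter> B)" using that fin by (simp add: finite_clique)
      moreover have "A \<inter> B \<noteq> {}" using that meet by blast
      ultimately show ?thesis by (simp add: Suc_le_eq card_gt_0_iff)
    qed
    have size: "finite C \<and> card C = Suc s" if "C \<in> ?\<F>" for C
      using that finite_clique[OF that fin] by (simp add: cliques_def)
    from intersecting_kernel[OF size meet' nontrivial] obtain P where
      P: "finite P" "card P \<le> 2 ^ Suc s * Suc s" "\<And>S. S \<in> P \<Longrightarrow> finite S \<and> card S = Suc 1"
        "\<And>C. C \<in> ?\<F> \<Longrightarrow> \<exists>S\<in>P. S \<subseteq> C" by blast
    \<comment> \<open>each r-clique contains a pair from P, so deleting these edges destroys all r-cliques\<close>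
    have free: "cliques V (E - P) (Suc s) = {}"
    proof (rule equals0I)
      fix C assume C: "C \<in> cliques V (E - P) (Suc s)"
      then have "C \<in> ?\<F>" using cliques_mono[of V V "E - P" E] by blast
      then obtain S where S: "S \<in> P" "S \<subseteq> C" using P(4) by blast
      moreover have "card S = 2" using P(3)[OF S(1)] by simp
      ultimately have "S \<in> E - P" using C by (auto simp: cliques_def is_clique_iff_pairs)
      with S show False by simp
    qed
    have "C \<in> cliques V (E - P) k \<union> {C. C \<subseteq> V \<and> card C = k \<and> (\<exists>S\<in>P. S \<subseteq> C)}"
      if C: "C \<in> cliques V E k" for C
      using C by (auto simp: cliques_def is_clique_iff_pairs)
    then have "cliques V E k \<subseteq> cliques V (E - P) k \<union> {C. C \<subseteq> V \<and> card C = k \<and> (\<exists>S\<in>P. S \<subseteq> C)}"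
      by blast
    then have "card (cliques V E k)
        \<le> card (cliques V (E - P) k \<union> {C. C \<subseteq> V \<and> card C = k \<and> (\<exists>S\<in>P. S \<subseteq> C)})"
      using fin by (intro card_mono) auto
    also have "\<dots> \<le> card (cliques V (E - P) k) + card {C. C \<subseteq> V \<and> card C = k \<and> (\<exists>S\<in>P. S \<subseteq> C)}"
      by (rule card_Un_le)
    also have "\<dots> \<le> card (turan_cliques (Suc N) s k) + card P * Suc N ^ (k - 2)"
    proof (rule add_mono)
      show "card (cliques V (E - P) k) \<le> card (turan_cliques (Suc N) s k)"
        using zykov[OF fin free, of k] cardV by simp
      show "card {C. C \<subseteq> V \<and> card C = k \<and> (\<exists>S\<in>P. S \<subseteq> C)} \<le> card P * Suc N ^ (k - 2)"
        using card_supersets_le[OF fin P(1), of 2 k] P(3) cardV by simp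
    qed
    also have "card P * Suc N ^ (k - 2) \<le> 2 ^ Suc s * Suc s * Suc N ^ (k - 2)"
      using P(2) by (rule mult_right_mono) simp
    also have "\<dots> \<le> (N div s) ^ (k - 1)" by (rule large[OF k2])
    finally have "card (cliques V E k) \<le> card (turan_cliques (Suc N) s k) + (N div s) ^ (k - 1)"
      by simp
    then show ?thesis using card_turan_cliques_Suc[OF k2 k(2), of N] by simp
  qed
qed

text \<open>Removing the common core M maps the cliques injectively to s-cliques in the common neighbourhood U of
  M. An (s+1)-clique in U would extend by M to a forbidden clique, so Zykov's theorem applies to U.\<close>

lemma card_cliques_common_subset:
  assumes fin: "finite V" and M: "M \<subseteq> V" "\<And>C. C \<in> cliques V E (card M + s) \<Longrightarrow> M \<subseteq> C"
    and free: "cliques V E (Suc (card M + s)) = {}"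
  shows "card (cliques V E (card M + s)) \<le> card (turan_cliques (card V - card M) s s)"
proof (cases "cliques V E (card M + s) = {}")
  case False
  have finM: "finite M" using M fin finite_subset by blast
  define U where "U = {v \<in> V - M. \<forall>x\<in>M. {x, v} \<in> E}"
  have finU: "finite U" using fin by (simp add: U_def)
  from False obtain C0 where "C0 \<in> cliques V E (card M + s)" by blast
  then have cM: "is_clique E M" using M(2) by (auto simp: cliques_def intro: is_clique_subset)
  have "cliques U E (Suc s) = {}"
  proof (rule equals0I)
    fix D assume D: "D \<in> cliques U E (Suc s)"
    then have DU: "D \<subseteq> U" by (simp add: cliques_def)
    have "finite D" "M \<inter> D = {}" using finite_subset[OF DU finU] DU by (auto simp: U_def)
    then have "card (M \<union> D) = card M + card D"
      using finM by (intro card_Un_disjoint)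
    then have "M \<union> D \<in> cliques V E (Suc (card M + s))"
      using D cM M(1) by (auto simp: cliques_def is_clique_Un U_def)
    then show False using free by simp
  qed
  from zykov[OF finU this, of s]
  have "card (cliques U E s) \<le> card (turan_cliques (card U) s s)" .
  also have "\<dots> \<le> card (turan_cliques (card V - card M) s s)"
  proof -
    have "card U \<le> card (V - M)" using fin by (intro card_mono) (auto simp: U_def)
    also have "\<dots> = card V - card M" using finM M by (simp add: card_Diff_subset)
    finally show ?thesis by (intro card_mono turan_cliques_mono) auto
  qed
  finally have 1: "card (cliques U E s) \<le> card (turan_cliques (card V - card M) s s)" .
  have "C - M \<in> cliques U E s" if C: "C \<in> cliques V E (card M + s)" for C
  proof -
    have "M \<subseteq> C" using M(2)[OF C] .
    moreover from this have "card (C - M) = s"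
      using C finM by (simp add: card_Diff_subset cliques_def)
    moreover have "{x, v} \<in> E" if "x \<in> M" "v \<in> C - M" for x v
    proof -
      have "x \<in> C" "v \<in> C" "x \<noteq> v" using \<open>M \<subseteq> C\<close> that by auto
      then show ?thesis using C by (simp add: cliques_def is_clique_def)
    qed
    ultimately show ?thesis
      using C by (auto simp: cliques_def U_def intro: is_clique_subset)
  qed
  moreover have "inj_on (\<lambda>C. C - M) (cliques V E (card M + s))"
  proof (rule inj_onI)
    fix C C' assume "C \<in> cliques V E (card M + s)" "C' \<in> cliques V E (card M + s)" "C - M = C' - M"
    then show "C = C'" using M(2)[of C] M(2)[of C'] by blast
  qed
  ultimately have "card (cliques V E (card M + s)) \<le> card (cliques U E s)"
    using finU by (intro card_inj_on_le[of "\<lambda>C. C - M"]) auto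
  with 1 show ?thesis by simp
qed simp

text \<open>The part of the theorem with \<open>r \<le> k\<close>; the right-hand side is the number of s-cliques in
  \<open>T(n-m, s)\<close>, each of which extends by \<open>K\<^sub>m\<close> to a k-clique of the join. For \<open>s = 0\<close>, that is
  \<open>k = 2r - 1\<close>, any two k-cliques coincide, which is why \<open>large\<close> only concerns \<open>s \<ge> 1\<close>.\<close>

lemma sum_card_large_cliques_le:
  assumes fin: "finite V" and meet: "pairwise_meeting (cliques V E r)"
    and k: "r \<le> k" "k < 2 * r" and m: "m = 2 * k - 2 * r + 1" and s: "s = 2 * r - k - 1"
    and large: "1 \<le> s \<Longrightarrow> 2 * r * (2 ^ (2 * r) * (2 * r)) * card V ^ (s - 1) \<le> ((card V - m) div s) ^ s"
  shows "(\<Sum>j\<in>{k..2 * r - 1}. card (cliques V E j)) \<le> card (turan_cliques (card V - m) s s)"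
proof -
  let ?\<F> = "cliques V E k"
  have ms: "m + s = k" using k m s by simp
  have finC: "finite C" if "C \<in> cliques V E j" for C j
    using finite_clique[OF that fin] .
  have common: "2 * j - 2 * r + 1 \<le> card (A \<inter> B)"
    if "A \<in> cliques V E j" "B \<in> cliques V E j" "k \<le> j" for A B j
  proof -
    have "r \<le> j" using k that(3) by simp
    moreover
    have "card (A \<union> B) < 2 * r"
      using card_Un_cliques_less[OF fin meet that(1) _ that(2)] k that(3) by simp
    moreover have "card A + card B = card (A \<union> B) + card (A \<inter> B)"
      using that finC by (intro card_Un_Int) auto
    moreover have "card A = j" "card B = j" using that by (auto simp: cliques_def)
    ultimately show ?thesis by simp
  qed
  show ?thesis
  proof (cases "\<exists>M. finite M \<and> card M = m \<and> (\<forall>C\<in>?\<F>. M \<subseteq> C)")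
    case True
    then obtain M where M: "finite M" "card M = m" "\<And>C. C \<in> ?\<F> \<Longrightarrow> M \<subseteq> C" by blast
    have free: "cliques V E (Suc k) = {}"
    proof (rule equals0I)
      fix D assume D: "D \<in> cliques V E (Suc k)"
      \<comment> \<open>a (k+1)-clique minus a point of M contains a k-clique that does not contain M\<close>
      have "M \<noteq> {}" using M(2) m by auto
      then obtain x where x: "x \<in> M" by blast
      have "k \<le> card (D - {x})" using D by (simp add: cliques_def card_Diff_singleton_if)
      then obtain C where C: "C \<subseteq> D - {x}" "card C = k" using obtain_subset_with_card_n by metis
      then have "C \<in> ?\<F>" using D by (auto simp: cliques_def intro: is_clique_subset)
      then show False using M(3) x C by blast
    qed
    have "(\<Sum>j\<in>{k..2 * r - 1}. card (cliques V E j)) = (\<Sum>j\<in>{k}. card (cliques V E j))"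
      using cliques_empty_larger[OF fin free] k by (intro sum.mono_neutral_right) auto
    also have "\<dots> = card ?\<F>" by simp
    also have "\<dots> \<le> card (turan_cliques (card V - m) s s)"
    proof (cases "?\<F> = {}")
      case False
      then have "M \<subseteq> V" using M(3) by (auto simp: cliques_def)
      then show ?thesis
        using card_cliques_common_subset[OF fin, of M E s] M free ms by simp
    qed simp
    finally show ?thesis .
  next
    case False
    then have nontrivial: "\<exists>C\<in>?\<F>. \<not> M \<subseteq> C" if "finite M" "card M = m" for M
      using that by blast
    have size: "finite C \<and> card C = k" if "C \<in> ?\<F>" for C
      using that finC[OF that] by (simp add: cliques_def)
    have meet': "m \<le> card (A \<inter> B)" if "A \<in> ?\<F>" "B \<in> ?\<F>" for A B
      using common[OF that] m by simp
    from intersecting_kernel[OF size meet' nontrivial] obtain P where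
      P: "finite P" "card P \<le> 2 ^ k * k" "\<And>S. S \<in> P \<Longrightarrow> finite S \<and> card S = Suc m"
        "\<And>C. C \<in> ?\<F> \<Longrightarrow> \<exists>S\<in>P. S \<subseteq> C" by blast
    show ?thesis
    proof (cases "s = 0")
      case True
      \<comment> \<open>here \<open>m = k\<close>, and a k-clique cannot contain a set of \<open>m + 1\<close> elements\<close>
      have "?\<F> = {}"
      proof (rule equals0I)
        fix C assume C: "C \<in> ?\<F>"
        then obtain S where S: "S \<in> P" "S \<subseteq> C" using P(4) by blast
        then have "card S \<le> card C" using size[OF C] by (intro card_mono) auto
        then show False using P(3)[OF S(1)] size[OF C] ms True by simp
      qed
      then have "cliques V E j = {}" if "j \<in> {k..2 * r - 1}" for j
        using cliques_empty_larger[OF fin] that by simp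
      then show ?thesis by simp
    next
      case False
      define b where "b = 2 ^ (2 * r) * (2 * r) * card V ^ (s - 1)"
      have pow: "2 ^ j \<le> (2 ^ (2 * r) :: nat)" if "j < 2 * r" for j
        using that by (intro power_increasing) auto
      have "card (cliques V E j) \<le> b" if j: "j \<in> {k..2 * r - 1}" for j
      proof (cases "j = k")
        case True
        have "?\<F> \<subseteq> {C. C \<subseteq> V \<and> card C = k \<and> (\<exists>S\<in>P. S \<subseteq> C)}"
          using P(4) cliques_subset_Pow[of V E k] by (auto dest: size)
        then have "card ?\<F> \<le> card {C. C \<subseteq> V \<and> card C = k \<and> (\<exists>S\<in>P. S \<subseteq> C)}"
          using fin by (intro card_mono) auto
        also have "\<dots> \<le> card P * card V ^ (k - Suc m)"
          by (rule card_supersets_le[OF fin P(1) P(3)])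
        also have "k - Suc m = s - 1" using ms by simp
        also have "card P * card V ^ (s - 1) \<le> b"
        proof -
          have "2 ^ k * k \<le> 2 ^ (2 * r) * (2 * r)"
            using pow[OF k(2)] k(2) by (intro mult_mono) auto
          then have "card P \<le> 2 ^ (2 * r) * (2 * r)" using P(2) by (rule order_trans[rotated])
          then show ?thesis unfolding b_def by (rule mult_right_mono) simp
        qed
        finally show ?thesis using True by simp
      next
        case False
        then have j': "k < j" "j < 2 * r" using j k by auto
        show ?thesis
        proof (cases "cliques V E j = {}")
          case nonempty: False
          then obtain A where A: "A \<in> cliques V E j" by blast
          then have A': "card A = j" "A \<subseteq> V" by (auto simp: cliques_def)
          \<comment> \<open>larger cliques share so many vertices that meeting a single one of them is restrictive enough\<close>
          define Q where "Q = {S. S \<subseteq> A \<and> card S = 2 * j - 2 * r + 1}"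
          have "Q \<subseteq> Pow A" by (auto simp: Q_def)
          then have finQ: "finite Q" and cardQ: "card Q \<le> 2 ^ j"
            using A' finC[OF A] card_mono[of "Pow A" Q] finite_subset[of Q "Pow A"]
            by (auto simp: card_Pow)
          have Q: "finite S \<and> card S = 2 * j - 2 * r + 1" if "S \<in> Q" for S
            using that finite_subset[OF _ finC[OF A]] by (auto simp: Q_def)
          have "\<exists>S\<in>Q. S \<subseteq> C" if C: "C \<in> cliques V E j" for C
          proof -
            have "2 * j - 2 * r + 1 \<le> card (C \<inter> A)" using common[OF C A] j' by simp
            then obtain S where "S \<subseteq> C \<inter> A" "card S = 2 * j - 2 * r + 1"
              using obtain_subset_with_card_n by metis
            then show ?thesis by (auto simp: Q_def)
          qed
          then have "cliques V E j \<subseteq> {C. C \<subseteq> V \<and> card C = j \<and> (\<exists>S\<in>Q. S \<subseteq> C)}"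
            by (auto simp: cliques_def)
          then have "card (cliques V E j) \<le> card {C. C \<subseteq> V \<and> card C = j \<and> (\<exists>S\<in>Q. S \<subseteq> C)}"
            using fin by (intro card_mono) auto
          also have "\<dots> \<le> card Q * card V ^ (j - (2 * j - 2 * r + 1))"
            by (rule card_supersets_le[OF fin finQ Q])
          also have "\<dots> \<le> (2 ^ (2 * r) * (2 * r)) * card V ^ (s - 1)"
          proof (rule mult_mono)
            have "card Q \<le> 2 ^ (2 * r)" using cardQ pow[OF j'(2)] by (rule order_trans)
            also have "\<dots> \<le> 2 ^ (2 * r) * (2 * r)" using j' by simp
            finally show "card Q \<le> 2 ^ (2 * r) * (2 * r)" .
            have "card V \<ge> 1" using card_mono[OF fin A'(2)] A'(1) j' by simp
            then show "card V ^ (j - (2 * j - 2 * r + 1)) \<le> card V ^ (s - 1)"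
              using j' s k by (intro power_increasing) auto
          qed auto
          finally show ?thesis by (simp add: b_def)
        qed simp
      qed
      then have "(\<Sum>j\<in>{k..2 * r - 1}. card (cliques V E j)) \<le> (\<Sum>j\<in>{k..2 * r - 1}. b)"
        by (rule sum_mono)
      also have "\<dots> \<le> 2 * r * b"
      proof -
        have "card {k..2 * r - 1} \<le> 2 * r" using k by auto
        then show ?thesis unfolding sum_constant by simp
      qed
      also have "\<dots> \<le> ((card V - m) div s) ^ s"
        using large False by (simp add: b_def mult.assoc)
      also have "\<dots> \<le> card (turan_cliques (card V - m) s s)"
        by (rule card_turan_cliques_ge)
      finally show ?thesis .
    qed
  qed
qed

section \<open>Joins\<close>

lemma is_clique_join:
  assumes "A \<subseteq> verts G" "B \<subseteq> verts H"
  shows "is_clique (edges (join G H)) (Inl ` A \<union> Inr ` B) \<longleftrightarrow>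
    is_clique (edges G) A \<and> is_clique (edges H) B"
proof -
  have l: "{Inl u, Inl v} \<in> edges (join G H) \<longleftrightarrow> {u, v} \<in> edges G" for u v
  proof -
    have "{Inl u, Inl v} \<in> edges (join G H) \<longleftrightarrow> (\<exists>e\<in>edges G. {Inl u, Inl v :: 'a + 'b} = Inl ` e)"
      by (fastforce simp: join_def disjoint_union_def doubleton_eq_iff)
    also have "\<dots> \<longleftrightarrow> (\<exists>e\<in>edges G. Inl ` {u, v} = (Inl ` e :: ('a + 'b) set))" by simp
    also have "\<dots> \<longleftrightarrow> {u, v} \<in> edges G" by (metis inj_Inl inj_image_eq_iff)
    finally show ?thesis .
  qed
  have r: "{Inr u, Inr v} \<in> edges (join G H) \<longleftrightarrow> {u, v} \<in> edges H" for u v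
  proof -
    have "{Inr u, Inr v} \<in> edges (join G H) \<longleftrightarrow> (\<exists>e\<in>edges H. {Inr u, Inr v :: 'a + 'b} = Inr ` e)"
      by (fastforce simp: join_def disjoint_union_def doubleton_eq_iff)
    also have "\<dots> \<longleftrightarrow> (\<exists>e\<in>edges H. Inr ` {u, v} = (Inr ` e :: ('a + 'b) set))" by simp
    also have "\<dots> \<longleftrightarrow> {u, v} \<in> edges H" by (metis inj_Inr inj_image_eq_iff)
    finally show ?thesis .
  qed
  have lr: "{Inl u, Inr v} \<in> edges (join G H)" if "u \<in> A" "v \<in> B" for u v
    using that assms by (auto simp: join_def)
  show ?thesis
    unfolding is_clique_Un using lr by (auto simp: is_clique_def l r)
qed

lemma cliques_join_cases:
  assumes C: "C \<in> cliques (verts (join G H)) (edges (join G H)) k" and fin: "finite C"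
  obtains A B i j where "A \<in> cliques (verts G) (edges G) i" "B \<in> cliques (verts H) (edges H) j"
    "C = Inl ` A \<union> Inr ` B" "i + j = k"
proof -
  define A B where "A = Inl -` C" and "B = Inr -` C"
  have CAB: "C = Inl ` A \<union> Inr ` B"
    unfolding A_def B_def by (auto simp: image_iff) (metis obj_sumE)
  have V: "A \<subseteq> verts G" "B \<subseteq> verts H"
    using C by (auto simp: A_def B_def cliques_def join_def)
  have "finite (Inl ` A :: ('a + 'b) set)" "finite (Inr ` B :: ('a + 'b) set)"
    using fin CAB by simp_all
  then have "card C = card (Inl ` A :: ('a + 'b) set) + card (Inr ` B :: ('a + 'b) set)"
    unfolding CAB by (intro card_Un_disjoint) auto
  then have "card A + card B = k" using C by (simp add: card_image cliques_def)
  moreover have "is_clique (edges G) A" "is_clique (edges H) B"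
    using C is_clique_join[OF V] CAB by (auto simp: cliques_def)
  ultimately show thesis
    using that[of A "card A" B "card B"] V CAB by (simp add: cliques_def)
qed

text \<open>Cliques of the join are the unions of a clique on each side; distinct pairs give distinct unions.\<close>

lemma card_cliques_join_ge:
  assumes fin: "finite (verts G)" "finite (verts H)"
  shows "(\<Sum>i\<le>k. card (cliques (verts G) (edges G) i) * card (cliques (verts H) (edges H) (k - i)))
    \<le> card (cliques (verts (join G H)) (edges (join G H)) k)"
proof -
  let ?I = "Sigma {..k} (\<lambda>i. cliques (verts G) (edges G) i \<times> cliques (verts H) (edges H) (k - i))"
  let ?f = "\<lambda>(i :: nat, A, B). Inl ` A \<union> Inr ` B"
  have "?f x \<in> cliques (verts (join G H)) (edges (join G H)) k" if "x \<in> ?I" for x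
  proof -
    obtain i A B where x: "x = (i, A, B)" "i \<le> k"
      and A: "A \<in> cliques (verts G) (edges G) i"
      and B: "B \<in> cliques (verts H) (edges H) (k - i)"
      using \<open>x \<in> ?I\<close> by auto
    have V: "A \<subseteq> verts G" "B \<subseteq> verts H" using A B by (auto simp: cliques_def)
    then have "finite A" "finite B" using fin finite_subset by blast+
    then have "card (Inl ` A \<union> Inr ` B :: ('a + 'b) set) = card A + card B"
      by (subst card_Un_disjoint) (auto simp: card_image)
    then show ?thesis
      using A B V x is_clique_join[OF V] by (auto simp: cliques_def join_def)
  qed
  moreover have "inj_on ?f ?I"
  proof (rule inj_onI)
    fix x y assume xy: "x \<in> ?I" "y \<in> ?I" "?f x = ?f y"
    obtain i A B i' A' B' where x: "x = (i, A, B)" and y: "y = (i', A', B')"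
      by (metis prod_cases3)
    have A: "A \<in> cliques (verts G) (edges G) i" "A' \<in> cliques (verts G) (edges G) i'"
      and eq: "Inl ` A \<union> Inr ` B = Inl ` A' \<union> Inr ` B'"
      using xy x y by auto
    have "A = Inl -` (Inl ` A \<union> Inr ` B)" "A' = Inl -` (Inl ` A' \<union> Inr ` B')"
      "B = Inr -` (Inl ` A \<union> Inr ` B)" "B' = Inr -` (Inl ` A' \<union> Inr ` B')" by auto
    then have "A = A'" "B = B'" using eq by metis+
    then show "x = y" using A x y by (auto simp: cliques_def)
  qed
  moreover have "finite (cliques (verts (join G H)) (edges (join G H)) k)"
    using fin by (simp add: join_def)
  ultimately have "card ?I \<le> card (cliques (verts (join G H)) (edges (join G H)) k)"
    by (intro card_inj_on_le[of ?f]) auto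
  then show ?thesis
    using fin by (simp add: card_SigmaI card_cartesian_product)
qed

lemma simple_graph_join:
  assumes "simple_graph G" "simple_graph H"
  shows "simple_graph (join G H)"
proof -
  have 1: "Inl ` e \<subseteq> Inl ` verts G" "card (Inl ` e) = 2" if "e \<in> edges G" for e
    using that assms unfolding simple_graph_def by (blast, simp add: card_image)
  have 2: "Inr ` e \<subseteq> Inr ` verts H" "card (Inr ` e) = 2" if "e \<in> edges H" for e
    using that assms unfolding simple_graph_def by (blast, simp add: card_image)
  show ?thesis
    unfolding simple_graph_def
  proof (intro conjI ballI)
    show "finite (verts (join G H))" using assms by (simp add: simple_graph_def join_def)
  next
    fix e assume "e \<in> edges (join G H)"
    then show "e \<subseteq> verts (join G H)" using 1 2 by (fastforce simp: join_def disjoint_union_def)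
  next
    fix e assume "e \<in> edges (join G H)"
    then show "card e = 2" using 1 2 by (auto simp: join_def disjoint_union_def)
  qed
qed

lemma cliques_complete_graph_self: "cliques (verts (complete_graph m)) (edges (complete_graph m)) m = {{..<m}}"
proof -
  have "C = {..<m}" if "C \<subseteq> {..<m}" "card C = m" for C
    using that by (intro card_subset_eq) auto
  then show ?thesis
    by (auto simp: cliques_def complete_graph_def is_clique_def)
qed

text \<open>A clique has at most s vertices in the Turan graph, so each r-clique uses at least \<open>r - s\<close> of the m
  vertices of the complete graph; there is no room for two disjoint such sets.\<close>

lemma pairwise_meeting_join_turan:
  assumes "m < 2 * (r - s)"
  shows "pairwise_meeting (cliques (verts (join (complete_graph m) (turan_graph N s)))
    (edges (join (complete_graph m) (turan_graph N s))) r)" (is "pairwise_meeting ?\<F>")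
proof (intro ballI notI)
  have finV: "finite (verts (join (complete_graph m) (turan_graph N s)))"
    by (simp add: join_def complete_graph_def)
  have left: "\<exists>A \<subseteq> {..<m}. r - s \<le> card A \<and> Inl ` A \<subseteq> C" if C: "C \<in> ?\<F>" for C
  proof -
    have "finite C" using finite_clique[OF C finV] .
    from cliques_join_cases[OF C this] obtain A B i j where
      A: "A \<in> cliques (verts (complete_graph m)) (edges (complete_graph m)) i"
      and B: "B \<in> turan_cliques N s j" and "C = Inl ` A \<union> Inr ` B" "i + j = r" .
    moreover have "j \<le> s" using turan_cliques_card_le[OF B] .
    ultimately show ?thesis by (intro exI[of _ A]) (auto simp: cliques_def complete_graph_def)
  qed
  fix C C' assume "C \<in> ?\<F>" "C' \<in> ?\<F>" and disj: "C \<inter> C' = {}"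
  then obtain A A' where A: "A \<subseteq> {..<m}" "r - s \<le> card A" "Inl ` A \<subseteq> C"
    and A': "A' \<subseteq> {..<m}" "r - s \<le> card A'" "Inl ` A' \<subseteq> C'"
    using left by meson
  have "finite A" "finite A'" using A A' finite_subset by blast+
  moreover have "A \<inter> A' = {}" using A A' disj by blast
  ultimately have "card A + card A' = card (A \<union> A')" by (simp add: card_Un_disjoint)
  also have "\<dots> \<le> m" using card_mono[of "{..<m}" "A \<union> A'"] A A' by simp
  finally show False using assms A A' by simp
qed

section \<open>The extremal numbers\<close>

lemma Max_attained:
  fixes f :: "'a \<Rightarrow> nat"
  assumes "\<And>x. P x \<Longrightarrow> f x \<le> b" "P y" "b \<le> f y"
  shows "Max {f x | x. P x} = b"
proof (rule Max_eqI)
  show "finite {f x | x. P x}" using assms(1) by (auto intro: finite_subset[of _ "{..b}"])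
  have "f y = b" using assms by (simp add: le_antisym)
  then show "b \<in> {f x | x. P x}" using assms(2) by blast
qed (use assms in auto)

text \<open>The degenerate bounds have the form \<open>c n\<^sup>p\<close> and the parts of the Turan graphs have order at least
  \<open>n div (2r)\<close> by \<open>div_le_part_size\<close> below. Since \<open>n \<le> 4r (n div (2r))\<close>, one more factor of
  \<open>n div (2r)\<close> absorbs the constants.\<close>

lemma mult_power_le_power_Suc:
  fixes n r :: nat
  assumes "1 \<le> r" "4 * r \<le> n" "c * (4 * r) ^ (2 * r) \<le> n div (2 * r)" "p \<le> 2 * r"
  shows "c * n ^ p \<le> (n div (2 * r)) ^ Suc p"
proof -
  define q where "q = n div (2 * r)"
  have "4 * r div (2 * r) \<le> q" unfolding q_def using assms by (intro div_le_mono)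
  then have "1 \<le> q" using assms by simp
  have "n = 2 * r * q + n mod (2 * r)" by (simp add: q_def)
  also have "\<dots> \<le> 2 * r * q + 2 * r * 1" using assms by (intro add_left_mono) simp
  also have "\<dots> \<le> 2 * r * q + 2 * r * q" using \<open>1 \<le> q\<close> by (intro add_left_mono mult_left_mono) auto
  also have "\<dots> = 4 * r * q" by simp
  finally have "n ^ p \<le> (4 * r * q) ^ p" by (rule power_mono) simp
  also have "\<dots> \<le> (4 * r) ^ (2 * r) * q ^ p"
    unfolding power_mult_distrib[of "4 * r"] using assms
    by (intro mult_right_mono power_increasing) auto
  finally have "c * n ^ p \<le> c * (4 * r) ^ (2 * r) * q ^ p" by simp
  also have "\<dots> \<le> q * q ^ p" using assms by (intro mult_right_mono) (auto simp: q_def)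
  finally show ?thesis by (simp add: q_def)
qed

lemma div_le_part_size:
  fixes n r :: nat
  assumes "4 * r \<le> n" "m \<le> 2 * r" "1 \<le> s" "s \<le> r"
  shows "n div (2 * r) \<le> (n - m) div s"
proof -
  have "n div (2 * r) = n div 2 div r" by (simp add: div_mult2_eq)
  also have "\<dots> \<le> (n - m) div r" using assms by (intro div_le_mono) auto
  also have "\<dots> \<le> (n - m) div s" using assms by (intro div_le_mono2) auto
  finally show ?thesis .
qed

text \<open>For \<open>s = 0\<close> the join is \<open>K\<^sub>m\<close> and isolated vertices are added, which would change the number of
  copies of \<open>K\<^sub>1\<close>; hence the restriction on k.\<close>

lemma realise_join:
  assumes "m < 2 * (r - s)" "r \<ge> 2" "m \<le> n"
  obtains G :: "nat ugraph" where "simple_graph G" "card (verts G) = n"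
    "free_of (disjoint_union (complete_graph r) (complete_graph r)) G"
    "\<And>k. k \<ge> 2 \<or> s > 0 \<Longrightarrow> num_copies (complete_graph k) G =
       num_copies (complete_graph k) (join (complete_graph m) (turan_graph (n - m) s))"
proof -
  let ?J = "join (complete_graph m) (turan_graph (n - m) s)"
  have J: "simple_graph ?J"
    by (intro simple_graph_join simple_graph_complete simple_graph_turan)
  have cardJ: "card (verts ?J) = m + card (verts (turan_graph (n - m) s))"
    by (simp add: join_def card_Plus complete_graph_def)
  then have "card (verts ?J) \<le> n" and full: "s > 0 \<Longrightarrow> card (verts ?J) = n"
    using assms by (auto simp: turan_graph_def)
  from embed_in_nat_graph[OF J this(1)] obtain G :: "nat ugraph" and f where
    G: "simple_graph G" "card (verts G) = n" and f: "inj_on f (verts ?J)"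
    and cl: "\<And>j. j \<ge> 2 \<or> card (verts ?J) = n \<Longrightarrow>
       cliques (verts G) (edges G) j = (\<lambda>C. f ` C) ` cliques (verts ?J) (edges ?J) j" by blast
  have sub: "C \<subseteq> verts ?J" if "C \<in> cliques (verts ?J) (edges ?J) j" for C j
    using that by (simp add: cliques_def)
  have "pairwise_meeting (cliques (verts G) (edges G) r)"
  proof (intro ballI)
    fix A B assume "A \<in> cliques (verts G) (edges G) r" "B \<in> cliques (verts G) (edges G) r"
    then have "A \<in> (\<lambda>C. f ` C) ` cliques (verts ?J) (edges ?J) r"
      "B \<in> (\<lambda>C. f ` C) ` cliques (verts ?J) (edges ?J) r"
      using cl[of r] assms(2) by simp_all
    then obtain A' B' where "A' \<in> cliques (verts ?J) (edges ?J) r" "A = f ` A'"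
      "B' \<in> cliques (verts ?J) (edges ?J) r" "B = f ` B'"
      by (elim imageE)
    moreover from this have "A' \<inter> B' \<noteq> {}"
      using pairwise_meeting_join_turan[OF assms(1), of "n - m"] by simp
    ultimately show "A \<inter> B \<noteq> {}" by auto
  qed
  then have "free_of (disjoint_union (complete_graph r) (complete_graph r)) G"
    by (simp add: free_of_two_cliques_iff[OF G(1)])
  moreover have "num_copies (complete_graph k) G = num_copies (complete_graph k) ?J"
    if "k \<ge> 2 \<or> s > 0" for k
  proof -
    have "inj_on (\<lambda>C. f ` C) (cliques (verts ?J) (edges ?J) k)"
    proof (rule inj_onI)
      fix A B assume "A \<in> cliques (verts ?J) (edges ?J) k" "B \<in> cliques (verts ?J) (edges ?J) k"
        "f ` A = f ` B"
      then show "A = B" using inj_on_image_eq_iff[OF f] sub by simp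
    qed
    then show ?thesis
      using that full cl[of k]
      by (auto simp: num_copies_complete[OF G(1)] num_copies_complete[OF J] card_image)
  qed
  ultimately show thesis using that G by blast
qed

theorem theorem1p1:
  fixes r :: nat
  assumes "r \<ge> 2"
  shows "\<exists>n0::nat. \<forall>n\<ge>n0.
    (\<forall>k. 1 \<le> k \<and> k < r \<longrightarrow>
       ex n (complete_graph k) (disjoint_union (complete_graph r) (complete_graph r)) =
       num_copies (complete_graph k) (join (complete_graph 1) (turan_graph (n - 1) (r - 1)))) \<and>
    (\<forall>k. r \<le> k \<and> k < 2 * r \<longrightarrow>
       ex_family n (complete_graph ` {k..2 * r - 1})
         (disjoint_union (complete_graph r) (complete_graph r)) =
       num_copies (complete_graph k)
         (join (complete_graph (2 * k - 2 * r + 1))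
               (turan_graph (n - (2 * k - 2 * r + 1)) (2 * r - k - 1))))"
proof -
  let ?F = "disjoint_union (complete_graph r) (complete_graph r)"
  \<comment> \<open>c is the constant of \<open>sum_card_large_cliques_le\<close>; it also dominates that of \<open>card_small_cliques_le\<close>\<close>
  define c where "c = 2 * r * (2 ^ (2 * r) * (2 * r))"
  define n0 where "n0 = 2 * r * (c * (4 * r) ^ (2 * r)) + 4 * r"
  have r1: "1 \<le> r" using assms by simp
  show ?thesis
  proof (intro exI[of _ n0] allI impI conjI)
    fix n k assume n: "n0 \<le> n" and "1 \<le> k \<and> k < r"
    then have k: "1 \<le> k" "k \<le> r - 1" by auto
    have n4: "4 * r \<le> n" using n by (simp add: n0_def)
    have nc: "c * (4 * r) ^ (2 * r) \<le> n div (2 * r)"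
      using div_le_mono[of "2 * r * (c * (4 * r) ^ (2 * r))" n "2 * r"] n r1 by (simp add: n0_def)
    let ?J = "join (complete_graph 1) (turan_graph (n - 1) (r - 1))"
    have J: "simple_graph ?J"
      by (intro simple_graph_join simple_graph_complete simple_graph_turan)
    \<comment> \<open>the first part: G0 attains the maximum, and the cliques of the join with no vertex or the
      only vertex of \<open>K\<^sub>1\<close> account for the upper bound\<close>
    obtain G0 :: "nat ugraph" where G0: "simple_graph G0" "card (verts G0) = n" "free_of ?F G0"
      "num_copies (complete_graph k) G0 = num_copies (complete_graph k) ?J"
      using realise_join[of 1 r "r - 1" n] assms n4 by auto
    have "card (turan_cliques (n - 1) (r - 1) k) + card (turan_cliques (n - 1) (r - 1) (k - 1))
      = (\<Sum>i\<in>{0, 1}. card (cliques (verts (complete_graph 1)) (edges (complete_graph 1)) i)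
           * card (turan_cliques (n - 1) (r - 1) (k - i)))"
      unfolding One_nat_def[symmetric]
      using cliques_complete_graph_self[of 1] cliques_0[of "verts (complete_graph 1)"]
      by (simp add: complete_graph_def)
    also have "\<dots> \<le> (\<Sum>i\<le>k. card (cliques (verts (complete_graph 1)) (edges (complete_graph 1)) i)
           * card (turan_cliques (n - 1) (r - 1) (k - i)))"
      using k by (intro sum_mono2) auto
    also have "\<dots> \<le> card (cliques (verts ?J) (edges ?J) k)"
      by (rule card_cliques_join_ge) (simp_all add: complete_graph_def)
    finally have J_ge: "card (turan_cliques (n - 1) (r - 1) k)
        + card (turan_cliques (n - 1) (r - 1) (k - 1)) \<le> num_copies (complete_graph k) ?J"
      unfolding num_copies_complete[OF J] .
    show "ex n (complete_graph k) ?F = num_copies (complete_graph k) ?J"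
      unfolding ex_def
    proof (rule Max_attained[where y = G0])
      fix G :: "nat ugraph" assume G: "simple_graph G \<and> card (verts G) = n \<and> free_of ?F G"
      then have meet: "pairwise_meeting (cliques (verts G) (edges G) (Suc (r - 1)))"
        using free_of_two_cliques_iff[of G r] assms by simp
      have "card (cliques (verts G) (edges G) k)
        \<le> card (turan_cliques (n - 1) (r - 1) k) + card (turan_cliques (n - 1) (r - 1) (k - 1))"
      proof (rule card_small_cliques_le[OF _ _ meet k])
        show "finite (verts G)" "card (verts G) = Suc (n - 1)"
          using G n4 r1 by (auto simp: simple_graph_def)
        assume k2: "2 \<le> k"
        have "2 ^ Suc (r - 1) * Suc (r - 1) \<le> c"
        proof -
          have "2 ^ r * r \<le> (2 ^ (2 * r) * (2 * r) :: nat)"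
            by (intro mult_mono power_increasing) auto
          also have "\<dots> \<le> c" unfolding c_def using r1 by simp
          finally show ?thesis using r1 by simp
        qed
        then have "2 ^ Suc (r - 1) * Suc (r - 1) * Suc (n - 1) ^ (k - 2) \<le> c * n ^ (k - 2)"
          using n4 r1 by (intro mult_mono) auto
        also have "\<dots> \<le> (n div (2 * r)) ^ Suc (k - 2)"
          using k by (intro mult_power_le_power_Suc[OF r1 n4 nc]) auto
        also have "\<dots> \<le> ((n - 1) div (r - 1)) ^ Suc (k - 2)"
          using assms n4 by (intro power_mono div_le_part_size) auto
        also have "Suc (k - 2) = k - 1" using k2 by simp
        finally show "2 ^ Suc (r - 1) * Suc (r - 1) * Suc (n - 1) ^ (k - 2)
          \<le> ((n - 1) div (r - 1)) ^ (k - 1)" .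
      qed
      with J_ge show "num_copies (complete_graph k) G \<le> num_copies (complete_graph k) ?J"
        using G by (simp add: num_copies_complete)
    qed (use G0 in auto)
  next
    fix n k assume n: "n0 \<le> n" and k: "r \<le> k \<and> k < 2 * r"
    have n4: "4 * r \<le> n" using n by (simp add: n0_def)
    have nc: "c * (4 * r) ^ (2 * r) \<le> n div (2 * r)"
      using div_le_mono[of "2 * r * (c * (4 * r) ^ (2 * r))" n "2 * r"] n r1 by (simp add: n0_def)
    define m s where "m = 2 * k - 2 * r + 1" and "s = 2 * r - k - 1"
    have ms: "m + s = k" "m < 2 * (r - s)" "m \<le> 2 * r" "s \<le> r"
      using k by (auto simp: m_def s_def)
    let ?J = "join (complete_graph m) (turan_graph (n - m) s)"
    have J: "simple_graph ?J"
      by (intro simple_graph_join simple_graph_complete simple_graph_turan)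
    have "m \<le> n" using ms n4 by simp
    then obtain G0 :: "nat ugraph" where G0: "simple_graph G0" "card (verts G0) = n" "free_of ?F G0"
      "num_copies (complete_graph k) G0 = num_copies (complete_graph k) ?J"
      using realise_join[OF ms(2) assms] k assms by (metis order_trans)
    \<comment> \<open>the cliques of the join that contain all of \<open>K\<^sub>m\<close> already reach the upper bound\<close>
    have "card (turan_cliques (n - m) s s)
      = (\<Sum>i\<in>{m}. card (cliques (verts (complete_graph m)) (edges (complete_graph m)) i)
           * card (turan_cliques (n - m) s (k - i)))"
      using ms by (simp add: cliques_complete_graph_self flip: ms(1))
    also have "\<dots> \<le> (\<Sum>i\<le>k. card (cliques (verts (complete_graph m)) (edges (complete_graph m)) i)
           * card (turan_cliques (n - m) s (k - i)))"
      using ms by (intro sum_mono2) auto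
    also have "\<dots> \<le> card (cliques (verts ?J) (edges ?J) k)"
      by (rule card_cliques_join_ge) (simp_all add: complete_graph_def)
    finally have J_ge: "card (turan_cliques (n - m) s s) \<le> num_copies (complete_graph k) ?J"
      unfolding num_copies_complete[OF J] .
    have inj: "inj complete_graph"
      by (rule injI) (metis card_lessThan complete_graph_def ugraph.select_convs(1))
    have family: "(\<Sum>H\<in>complete_graph ` {k..2 * r - 1}. num_copies H G)
      = (\<Sum>j\<in>{k..2 * r - 1}. num_copies (complete_graph j) G)" for G :: "nat ugraph"
      using inj by (subst sum.reindex) (auto intro: inj_on_subset)
    have "ex_family n (complete_graph ` {k..2 * r - 1}) ?F = num_copies (complete_graph k) ?J"
      unfolding ex_family_def family
    proof (rule Max_attained[where y = G0])
      fix G :: "nat ugraph" assume G: "simple_graph G \<and> card (verts G) = n \<and> free_of ?F G"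
      then have meet: "pairwise_meeting (cliques (verts G) (edges G) r)"
        using free_of_two_cliques_iff[of G r] by simp
      have "(\<Sum>j\<in>{k..2 * r - 1}. card (cliques (verts G) (edges G) j))
        \<le> card (turan_cliques (card (verts G) - m) s s)"
      proof (rule sum_card_large_cliques_le[OF _ meet _ _ m_def s_def])
        show "finite (verts G)" "r \<le> k" "k < 2 * r" using G k by (auto simp: simple_graph_def)
        assume s1: "1 \<le> s"
        have "c * n ^ (s - 1) \<le> (n div (2 * r)) ^ Suc (s - 1)"
          using ms by (intro mult_power_le_power_Suc[OF r1 n4 nc]) auto
        also have "\<dots> \<le> ((n - m) div s) ^ Suc (s - 1)"
          using ms n4 s1 by (intro power_mono div_le_part_size) auto
        finally show "2 * r * (2 ^ (2 * r) * (2 * r)) * card (verts G) ^ (s - 1)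
          \<le> ((card (verts G) - m) div s) ^ s"
          using G s1 by (simp add: c_def)
      qed
      with J_ge show "(\<Sum>j\<in>{k..2 * r - 1}. num_copies (complete_graph j) G)
          \<le> num_copies (complete_graph k) ?J"
        using G by (simp add: num_copies_complete)
    next
      have "num_copies (complete_graph k) G0
          \<le> (\<Sum>j\<in>{k..2 * r - 1}. num_copies (complete_graph j) G0)"
        using k by (intro member_le_sum) auto
      then show "num_copies (complete_graph k) ?J
          \<le> (\<Sum>j\<in>{k..2 * r - 1}. num_copies (complete_graph j) G0)"
        using G0(4) by simp
    qed (use G0 in auto)
    then show "ex_family n (complete_graph ` {k..2 * r - 1}) ?F =
      num_copies (complete_graph k)
         (join (complete_graph (2 * k - 2 * r + 1))
               (turan_graph (n - (2 * k - 2 * r + 1)) (2 * r - k - 1)))"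
      by (simp add: m_def s_def)
  qed
qed

end
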